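(* Let $\mathcal{L}\in C^{\infty}(\mathcal{J}^{2}(\mathcal{X}))$ be a second-order Lagrangian with density $\mathfrak{L}=\mathcal{L}\,\Omega$, and let $$\mathfrak{C}=\mathcal{L}\,\Omega+\rho_{\alpha}^{j}\,\omega^{\alpha}\wedge\Omega_{j}+\rho_{\alpha}^{1_{k},j}\,\omega_{1_{k}}^{\alpha}\wedge\Omega_{j},$$ with smooth functions $\rho_{\alpha}^{1_{k},j}\in C^{\infty}(\mathcal{J}^{2}(\mathcal{X}))$ and $\rho_{\alpha}^{j}\in C^{\infty}(\mathcal{J}^{3}(\mathcal{X}))$, $1\le j,k\le r$, $1\le\alpha\le m$. (1) (Domain conditions.) The form $\mathrm{hor}(j^{3}(\eta)\rfloor\mathrm{d}\mathfrak{C})$ contains no total derivatives $d_{I}\eta^{\alpha}$ with $1\le\#I\le 2$ of the variational field (that is, there are functions $A_\alpha$ with $\mathrm{hor}(j^{3}(\eta)\rfloor\mathrm{d}\mathfrak{C})=A_{\alpha}\eta^{\alpha}\Omega$ for every vertical vector field $\eta=\eta^{\alpha}(X,x)\partial_{\alpha}$) if and only if $$\rho_{\alpha}^{1_{k},j}+\rho_{\alpha}^{1_{j},k}=\partial_{\alpha}^{1_{k}+1_{j}}\mathcal{L}\ \ (k\neq j),\qquad \rho_{\alpha}^{1_{k},k}=\partial_{\alpha}^{1_{k}+1_{k}}\mathcal{L}\ \ (\text{no sum}),\qquad \rho_{\alpha}^{l}=\partial_{\alpha}^{1_{l}}\mathcal{L}-d_{1_{j}}(\rho_{\alpha}^{1_{l},j}).$$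 For every choice of coefficients satisfying these relations one has $$\mathrm{hor}(j^{3}(\eta)\rfloor\mathrm{d}\mathfrak{C})=\eta^{\alpha}\,(\delta_{\alpha}\mathcal{L})\,\Omega,\qquad \delta_{\alpha}\mathcal{L}=\sum_{\#I=0}^{2}(-1)^{\#I}d_{I}\partial_{\alpha}^{I}\mathcal{L},$$ so the resulting domain conditions do not depend on the remaining freedom in the choice of $\rho_{\alpha}^{1_{k},j}$, $k\ne j$. (2) (Boundary conditions.) For every such choice, $j^{3}(\eta)\rfloor\mathfrak{C}=\left(\rho_{\alpha}^{i}\eta^{\alpha}+\rho_{\alpha}^{1_{k},i}\,d_{1_{k}}\eta^{\alpha}\right)\Omega_{i}$. If the coefficients are moreover chosen with $$\rho_{\alpha}^{1_{k},r}=0,\quad k=1,\ldots,r-1,$$ then necessarily $\rho_{\alpha}^{1_{r},k}=\partial_{\alpha}^{1_{r}+1_{k}}\mathcal{L}$ for $k=1,\ldots,r$, and on a boundary (portion) of $\mathcal{S}$ parameterized by $X^{r}=\mathrm{const}$, the boundary expression $j^{3}(\eta)\rfloor\mathfrak{C}$, pulled back to this boundary (i.e. with $\mathrm{d}X^{r}=0$), equals $$\left(\rho_{\alpha}^{r}\,\eta^{\alpha}+\rho_{\alpha}^{1_{r},r}\,d_{1_{r}}\eta^{\alpha}\right)\Omega_{\partial},\qquad \rho_{\alpha}^{r}=\partial_{\alpha}^{1_{r}}\mathcal{L}-\sum_{k=1}^{r}d_{1_{k}}\left(\partial_{\alpha}^{1_{r}+1_{k}}\mathcal{L}\right),\qquad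 \rho_{\alpha}^{1_{r},r}=\partial_{\alpha}^{1_{r}+1_{r}}\mathcal{L},$$ so that it involves only $\eta^{\alpha}$ and $d_{1_{r}}\eta^{\alpha}$.
   Context: Let $\pi:\mathcal{X}\to\mathcal{D}$ be a smooth fibre bundle over an orientable $r$-dimensional manifold $\mathcal{D}$, $\dim\mathcal{X}=m+r$, with local adapted coordinates $(X^{i},x^{\alpha})$, $i=1,\ldots,r$, $\alpha=1,\ldots,m$. All statements are in such a coordinate chart. $\mathcal{S}\subset\mathcal{D}$ is an $r$-dimensional submanifold with boundary $\partial\mathcal{S}$. Summation over repeated indices is understood unless stated otherwise. $\mathcal{J}^{n}(\mathcal{X})$ is the $n$-th jet manifold of $\pi$ with coordinates $(X^{i},x_{J}^{\alpha})$, $0\le\#J\le n$, where $J=(J(1),\ldots,J(r))$ is a multi-index of non-negative integers, $\#J=\sum_i J(i)$, $x^\alpha_0=x^\alpha$, and $1_{k}$ is the multi-index with $k$-th entry $1$ and all others $0$. Functions and forms on lower jet manifolds are regarded as living on higher ones by pullback. Write $\partial_{i}=\partial/\partial X^{i}$, $\partial_{\alpha}^{J}=\partial/\partial x_{J}^{\alpha}$, $\partial_\alpha=\partial/\partial x^\alpha$ (each coordinate $x^\alpha_{1_k+1_j}=x^\alpha_{1_j+1_k}$ is counted once). Total derivative: $d_{1_{i}}=\partial_{i}+x_{J+1_{i}}^{\alpha}\partial_{\alpha}^{J}$, and $d_{J}=(d_{1_{1}})^{J(1)}\cdots(d_{1_{r}})^{J(r)}$. Contact forms: $\omega_{J}^{\alpha}=\mathrm{d}x_{J}^{\alpha}-x_{J+1_{i}}^{\alpha}\mathrm{d}X^{i}$,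 $\omega^{\alpha}=\omega^\alpha_0$. Horizontalisation $\mathrm{hor}$ is the exterior algebra homomorphism with $\mathrm{hor}(\mathrm{d}X^{i})=\mathrm{d}X^{i}$, $\mathrm{hor}(\mathrm{d}x_{J}^{\alpha})=x_{J+1_{i}}^{\alpha}\mathrm{d}X^{i}$, leaving functions unchanged. The $n$-th prolongation of a vertical vector field $\eta=\eta^{\alpha}(X,x)\partial_{\alpha}$ is $j^{n}(\eta)=\eta^{\alpha}\partial_{\alpha}+\sum_{1\le\#J\le n}d_{J}(\eta^{\alpha})\partial_{\alpha}^{J}$. The symbol $\rfloor$ denotes contraction of a vector field with a form. $\Omega=\mathrm{d}X^{1}\wedge\cdots\wedge\mathrm{d}X^{r}$, $\Omega_{i}=\partial_{i}\rfloor\Omega$. In coordinates adapted to the boundary, i.e. the boundary is given by $X^{r}=\mathrm{const}$, the boundary volume form is $\Omega_{\partial}=\partial_{r}\rfloor\Omega=\Omega_r$. *)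

theory Defs
  imports "HOL-Analysis.Analysis" "HOL-Library.Function_Algebras" "HOL-Library.Groups_Big_Fun"
begin

section \<open>Multi-indices and jet coordinates\<close>

text \<open>
  The index types \<open>'r\<close> (base, linearly ordered) and \<open>'m\<close> (fibre) play the roles of
  \<open>{1,...,r}\<close> and \<open>{1,...,m}\<close>. Multi-indices are functions \<open>'r \<Rightarrow> nat\<close>, with sum and zero
  from \<open>Function_Algebras\<close>.

  All jet manifolds of a chart are treated simultaneously: a point carries the coordinates
  \<open>X i\<close> (\<open>Base i\<close>) and \<open>x J \<alpha>\<close> (\<open>Fib \<alpha> J\<close>) for multi-indices of every order. A function on
  the \<open>n\<close>-th jet manifold is one that depends only on the coordinates with \<open>#J \<le> n\<close>, so that
  pullback to a higher jet manifold is the identity.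
\<close>

type_synonym 'r mi = "'r \<Rightarrow> nat"

definition mi_len :: "('r::finite) mi \<Rightarrow> nat" where
  "mi_len J = (\<Sum>i\<in>UNIV. J i)"

definition unit_mi :: "'r \<Rightarrow> 'r mi" where
  "unit_mi k = (\<lambda>i. if i = k then 1 else 0)"

text \<open>Sums over all multi-indices of bounded order are genuinely finite.\<close>

lemma finite_mi_len_le: "finite {J :: ('r::finite) mi. mi_len J \<le> n}"
proof (rule finite_subset)
  show "{J :: 'r mi. mi_len J \<le> n} \<subseteq> (\<Pi>\<^sub>E i\<in>UNIV. {..n})"
  proof
    fix J :: "'r mi" assume "J \<in> {J. mi_len J \<le> n}"
    moreover have "J i \<le> mi_len J" for i
      unfolding mi_len_def by (rule member_le_sum) auto
    ultimately show "J \<in> (\<Pi>\<^sub>E i\<in>UNIV. {..n})"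
      by (auto intro: order_trans)
  qed
  show "finite (\<Pi>\<^sub>E i\<in>(UNIV::'r set). {..n})"
    by (rule finite_PiE) auto
qed

datatype ('r, 'm) coord = Base 'r | Fib 'm "'r mi"

type_synonym ('r, 'm) jet = "('r, 'm) coord \<Rightarrow> real"
type_synonym ('r, 'm) tangent = "('r, 'm) coord \<Rightarrow> real"
type_synonym ('r, 'm) jfun = "('r, 'm) jet \<Rightarrow> real"
type_synonym ('r, 'm) vfield = "('r, 'm) jet \<Rightarrow> ('r, 'm) tangent"

text \<open>The jets over a chart with image \<open>V\<close>; there is no restriction on \<open>x J \<alpha>\<close> for \<open>#J \<ge> 1\<close>.\<close>

definition jets_over :: "((real^'r) \<times> (real^'m)) set \<Rightarrow> ('r::finite, 'm::finite) jet set" where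
  "jets_over V = {p. ((\<chi> i. p (Base i)), (\<chi> \<alpha>. p (Fib \<alpha> 0))) \<in> V}"


section \<open>Smooth functions on jet manifolds\<close>

definition pd :: "('r, 'm) coord \<Rightarrow> ('r, 'm) jfun \<Rightarrow> ('r, 'm) jfun" where
  "pd c F p = deriv (\<lambda>t. F (p(c := t))) (p c)"

definition has_order :: "((real^'r) \<times> (real^'m)) set \<Rightarrow> nat \<Rightarrow> ('r::finite, 'm::finite) jfun \<Rightarrow> bool" where
  "has_order V n F \<longleftrightarrow>
     (\<forall>p \<in> jets_over V. \<forall>q \<in> jets_over V.
        (\<forall>i. p (Base i) = q (Base i)) \<and>
        (\<forall>\<alpha> J. mi_len J \<le> n \<longrightarrow> p (Fib \<alpha> J) = q (Fib \<alpha> J)) \<longrightarrow> F p = F q)"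

text \<open>
  \<open>smooth_jet V n F\<close>: all iterated partial derivatives exist and are continuous. Continuity is
  with respect to the product topology on coordinates, which for functions of finite order
  amounts to continuity in the finitely many coordinates involved.
\<close>

definition smooth_jet :: "((real^'r) \<times> (real^'m)) set \<Rightarrow> nat \<Rightarrow> ('r::finite, 'm::finite) jfun \<Rightarrow> bool" where
  "smooth_jet V n F \<longleftrightarrow> has_order V n F \<and>
     (\<forall>cs. continuous_on (jets_over V) (foldr pd cs F) \<and>
        (\<forall>c. \<forall>p \<in> jets_over V. (\<lambda>t. foldr pd cs F (p(c := t))) differentiable (at (p c))))"


section \<open>Total derivatives and prolongation\<close>

text \<open>\<open>Sum_any\<close> sums over the support, which is finite for functions of finite order.\<close>

definition total_deriv :: "'r \<Rightarrow> ('r, 'm) jfun \<Rightarrow> ('r, 'm) jfun" where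
  "total_deriv i F p = pd (Base i) F p +
     Sum_any (\<lambda>(\<alpha>, J). p (Fib \<alpha> (J + unit_mi i)) * pd (Fib \<alpha> J) F p)"

definition total_deriv_mi :: "('r::{finite,linorder}) mi \<Rightarrow> ('r, 'm) jfun \<Rightarrow> ('r, 'm) jfun" where
  "total_deriv_mi J F = foldr (\<lambda>i. total_deriv i ^^ J i) (sorted_list_of_set UNIV) F"

text \<open>
  A vertical vector field \<open>\<eta>\<close> is given by components \<open>\<eta> \<alpha>\<close>, functions of order \<open>0\<close>, i.e. of
  \<open>(X, x)\<close> only.
\<close>

definition prolong :: "nat \<Rightarrow> ('m \<Rightarrow> ('r, 'm) jfun) \<Rightarrow> ('r::{finite,linorder}, 'm) vfield" where
  "prolong n \<eta> p c = (case c of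
      Base i \<Rightarrow> 0
    | Fib \<alpha> J \<Rightarrow> if mi_len J \<le> n then total_deriv_mi J (\<eta> \<alpha>) p else 0)"

definition variational_deriv :: "('r, 'm) jfun \<Rightarrow> 'm \<Rightarrow> ('r::{finite,linorder}, 'm) jfun" where
  "variational_deriv L \<alpha> p =
     (\<Sum>I | mi_len I \<le> 2. (-1) ^ mi_len I * total_deriv_mi I (pd (Fib \<alpha> I) L) p)"


section \<open>Differential forms\<close>

text \<open>
  A (possibly inhomogeneous) form assigns to a point a function on lists of tangent vectors; its
  component of degree \<open>k\<close> is the restriction to lists of length \<open>k\<close>. Addition is pointwise.
\<close>

type_synonym ('r, 'm) form = "('r, 'm) jet \<Rightarrow> ('r, 'm) tangent list \<Rightarrow> real"

definition fun_form :: "('r, 'm) jfun \<Rightarrow> ('r, 'm) form" where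
  "fun_form f p vs = (if vs = [] then f p else 0)"

definition dcoord :: "('r, 'm) coord \<Rightarrow> ('r, 'm) form" where
  "dcoord c p vs = (case vs of [v] \<Rightarrow> v c | _ \<Rightarrow> 0)"

definition scale_form :: "('r, 'm) jfun \<Rightarrow> ('r, 'm) form \<Rightarrow> ('r, 'm) form" (infixr "\<odot>" 75) where
  "(f \<odot> a) p vs = f p * a p vs"

text \<open>
  Exterior product as a sum over shuffles: \<open>S\<close> is the set of positions of the arguments that
  are passed to the left factor, and the exponent counts the inversions of the shuffle.
\<close>

definition wedge :: "('r, 'm) form \<Rightarrow> ('r, 'm) form \<Rightarrow> ('r, 'm) form" (infixr "\<and>\<^sub>e" 70) where
  "(a \<and>\<^sub>e b) p vs =
     (\<Sum>S\<in>Pow {..<length vs}.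
        (-1) ^ card {(i, j). i \<in> S \<and> j \<in> {..<length vs} - S \<and> j < i} *
        a p (nths vs S) * b p (nths vs (- S)))"

text \<open>
  Exterior derivative: the usual alternating sum over constant vector fields \<open>vs ! i\<close>, with
  the directional derivative expressed through partial derivatives.
\<close>

definition ext_d :: "('r, 'm) form \<Rightarrow> ('r, 'm) form" where
  "ext_d a p vs =
     (\<Sum>i<length vs. (-1) ^ i *
        Sum_any (\<lambda>c. (vs ! i) c * pd c (\<lambda>q. a q (nths vs (- {i}))) p))"

definition contract :: "('r, 'm) vfield \<Rightarrow> ('r, 'm) form \<Rightarrow> ('r, 'm) form" where
  "contract v a p vs = a p (v p # vs)"

definition contact_form :: "'m \<Rightarrow> ('r::finite) mi \<Rightarrow> ('r, 'm) form" where
  "contact_form \<alpha> J =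
     dcoord (Fib \<alpha> J) - (\<Sum>i\<in>UNIV. (\<lambda>p. p (Fib \<alpha> (J + unit_mi i))) \<odot> dcoord (Base i))"

text \<open>
  Horizontalisation evaluates a form on the horizontal parts of its arguments. The lemmas below
  identify it as the homomorphism of exterior algebras determined by its values on functions,
  \<open>dX i\<close> and \<open>dx J \<alpha>\<close>.
\<close>

definition hor_part :: "('r::finite, 'm) jet \<Rightarrow> ('r, 'm) tangent \<Rightarrow> ('r, 'm) tangent" where
  "hor_part p v c = (case c of
      Base i \<Rightarrow> v (Base i)
    | Fib \<alpha> J \<Rightarrow> (\<Sum>i\<in>UNIV. p (Fib \<alpha> (J + unit_mi i)) * v (Base i)))"

definition hor :: "('r::finite, 'm) form \<Rightarrow> ('r, 'm) form" where
  "hor a p vs = a p (map (hor_part p) vs)"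

lemma sum_form_apply: "(\<Sum>i\<in>A. a i) p vs = (\<Sum>i\<in>A. a i p vs)"
  for a :: "'i \<Rightarrow> ('r, 'm) form"
  by (induction A rule: infinite_finite_induct) simp_all

lemma hor_fun_form: "hor (fun_form f) = fun_form f"
  by (intro ext) (simp add: hor_def fun_form_def)

lemma hor_dcoord_Base: "hor (dcoord (Base i)) = dcoord (Base i)"
  by (intro ext) (simp add: hor_def dcoord_def hor_part_def split: list.split)

lemma hor_dcoord_Fib:
  "hor (dcoord (Fib \<alpha> J)) = (\<Sum>i\<in>UNIV. (\<lambda>p. p (Fib \<alpha> (J + unit_mi i))) \<odot> dcoord (Base i))"
  by (intro ext)
    (auto simp: hor_def dcoord_def hor_part_def sum_form_apply scale_form_def split: list.splits)

lemma hor_add: "hor (a + b) = hor a + hor b"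
  by (intro ext) (simp add: hor_def)

lemma hor_scale: "hor (f \<odot> a) = f \<odot> hor a"
  by (intro ext) (simp add: hor_def scale_form_def)

lemma hor_wedge: "hor (a \<and>\<^sub>e b) = hor a \<and>\<^sub>e hor b"
  by (intro ext) (simp add: hor_def wedge_def nths_map)

lemma ext_d_coordinate: "ext_d (fun_form (\<lambda>q. q c)) = dcoord c"
  for c :: "('r, 'm) coord"
proof (intro ext)
  fix p :: "('r, 'm) jet" and vs :: "('r, 'm) tangent list"
  have pd_coord: "pd c' (\<lambda>q. q c) p = (if c' = c then 1 else 0)" for c'
    by (simp add: pd_def)
  have "Sum_any (\<lambda>c'. v c' * (if c' = c then 1 else 0)) = v c" for v :: "('r, 'm) tangent"
  proof -
    have "Sum_any (\<lambda>c'. v c' * (if c' = c then 1 else 0)) =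
        (\<Sum>c'\<in>{c}. v c' * (if c' = c then 1 else 0))"
      by (rule Sum_any.expand_superset) auto
    then show ?thesis by simp
  qed
  then have single: "ext_d (fun_form (\<lambda>q. q c)) p [v] = v c" for v
    by (simp add: ext_d_def fun_form_def nths_Cons pd_coord)
  have pd_zero: "pd c' (\<lambda>q. 0) p = 0" for c'
    by (simp add: pd_def)
  have "nths vs (- {i}) \<noteq> []" if "length vs \<ge> 2" "i < length vs" for i
  proof -
    have "card {k. k < length vs \<and> k \<in> - {i}} = card ({..<length vs} - {i})"
      by (rule arg_cong[where f = card]) auto
    then have "length (nths vs (- {i})) = length vs - 1"
      using that by (simp add: length_nths)
    then show ?thesis using that by auto
  qed
  then have many: "ext_d (fun_form (\<lambda>q. q c)) p vs = 0" if "length vs \<ge> 2"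
    using that by (auto simp: ext_d_def fun_form_def pd_zero intro!: sum.neutral)
  show "ext_d (fun_form (\<lambda>q. q c)) p vs = dcoord c p vs"
  proof (cases vs)
    case Nil
    then show ?thesis by (simp add: ext_d_def dcoord_def)
  next
    case (Cons v ws)
    then show ?thesis
      using single many by (cases ws) (simp_all add: dcoord_def)
  qed
qed

definition form_eq_on :: "((real^'r) \<times> (real^'m)) set \<Rightarrow>
    ('r::finite, 'm::finite) form \<Rightarrow> ('r, 'm) form \<Rightarrow> bool" where
  "form_eq_on V a b \<longleftrightarrow> (\<forall>p \<in> jets_over V. \<forall>vs. a p vs = b p vs)"


section \<open>Volume forms and the boundary\<close>

definition vol :: "('r::{finite,linorder}, 'm) form" where
  "vol = foldr (\<lambda>i a. dcoord (Base i) \<and>\<^sub>e a) (sorted_list_of_set UNIV) (fun_form (\<lambda>_. 1))"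

definition vol_contr :: "'r \<Rightarrow> ('r::{finite,linorder}, 'm) form" where
  "vol_contr i = contract (\<lambda>p c. if c = Base i then 1 else 0) vol"

text \<open>The last base index, i.e. the index \<open>r\<close>.\<close>

definition last_ix :: "'r::{finite,linorder}" where
  "last_ix = Max UNIV"

definition vol_bdry :: "('r::{finite,linorder}, 'm) form" where
  "vol_bdry = vol_contr last_ix"

text \<open>
  Equality of the pullbacks of two forms to the hypersurface \<open>X r = const = c\<close>, i.e. at points of
  the hypersurface and on tangent vectors annihilated by \<open>dX r\<close>.
\<close>

definition form_eq_on_bdry :: "((real^'r::{finite,linorder}) \<times> (real^'m)) set \<Rightarrow> real \<Rightarrow>
    ('r, 'm::finite) form \<Rightarrow> ('r, 'm) form \<Rightarrow> bool" where
  "form_eq_on_bdry V c a b \<longleftrightarrow>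
     (\<forall>p \<in> jets_over V. p (Base last_ix) = c \<longrightarrow>
        (\<forall>vs. (\<forall>v \<in> set vs. v (Base last_ix) = 0) \<longrightarrow> a p vs = b p vs))"


section \<open>The form built from a second-order Lagrangian\<close>

text \<open>\<open>\<rho> \<alpha> j\<close> stands for \<open>rho_\<alpha>^j\<close>, and \<open>\<sigma> \<alpha> k j\<close> for \<open>rho_\<alpha>^{1_k,j}\<close>.\<close>

definition lepage_form :: "('r, 'm) jfun \<Rightarrow> ('m \<Rightarrow> 'r \<Rightarrow> ('r, 'm) jfun) \<Rightarrow>
    ('m \<Rightarrow> 'r \<Rightarrow> 'r \<Rightarrow> ('r, 'm) jfun) \<Rightarrow> ('r::{finite,linorder}, 'm::finite) form" where
  "lepage_form L \<rho> \<sigma> =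
     L \<odot> vol
     + (\<Sum>\<alpha>\<in>UNIV. \<Sum>j\<in>UNIV. \<rho> \<alpha> j \<odot> (contact_form \<alpha> 0 \<and>\<^sub>e vol_contr j))
     + (\<Sum>\<alpha>\<in>UNIV. \<Sum>k\<in>UNIV. \<Sum>j\<in>UNIV.
          \<sigma> \<alpha> k j \<odot> (contact_form \<alpha> (unit_mi k) \<and>\<^sub>e vol_contr j))"

definition coeff_relations :: "((real^'r::{finite,linorder}) \<times> (real^'m)) set \<Rightarrow> ('r, 'm) jfun \<Rightarrow>
    ('m \<Rightarrow> 'r \<Rightarrow> ('r, 'm) jfun) \<Rightarrow> ('m \<Rightarrow> 'r \<Rightarrow> 'r \<Rightarrow> ('r, 'm::finite) jfun) \<Rightarrow> bool" where
  "coeff_relations V L \<rho> \<sigma> \<longleftrightarrow>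
     (\<forall>p \<in> jets_over V. \<forall>\<alpha>.
        (\<forall>k j. k \<noteq> j \<longrightarrow> \<sigma> \<alpha> k j p + \<sigma> \<alpha> j k p = pd (Fib \<alpha> (unit_mi k + unit_mi j)) L p) \<and>
        (\<forall>k. \<sigma> \<alpha> k k p = pd (Fib \<alpha> (unit_mi k + unit_mi k)) L p) \<and>
        (\<forall>l. \<rho> \<alpha> l p = pd (Fib \<alpha> (unit_mi l)) L p - (\<Sum>j\<in>UNIV. total_deriv j (\<sigma> \<alpha> l j) p)))"

definition vertical_field :: "((real^'r) \<times> (real^'m)) set \<Rightarrow>
    ('m \<Rightarrow> ('r::finite, 'm::finite) jfun) \<Rightarrow> bool" where
  "vertical_field V \<eta> \<longleftrightarrow> (\<forall>\<alpha>. smooth_jet V 0 (\<eta> \<alpha>))"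

end

theory Submission
  imports Defs
begin

text \<open>
  Write \<open>C\<close> for the form built from \<open>L\<close>, \<open>\<rho>\<close> and \<open>\<sigma>\<close>, and \<open>w\<close> for the prolonged vertical field at a
  point \<open>p\<close>. The exterior derivative uses constant vector fields, so
  \<open>(w \<rfloor> dC)(h\<^sub>1, \<dots>, h\<^sub>n)\<close> is the derivative along \<open>w\<close> of \<open>q \<mapsto> C\<^sub>q(h\<^sub>1, \<dots>, h\<^sub>n)\<close> minus the alternating sum
  of the derivatives along \<open>h\<^sub>i\<close> of \<open>q \<mapsto> C\<^sub>q(w, \<dots>)\<close>. For vectors \<open>h\<^sub>i\<close> that are horizontal at \<open>p\<close>
  both kinds of terms collapse, thanks to \<open>dX\<^sup>i \<and> \<Omega>\<^sub>j = \<delta>\<^sub>i\<^sub>j \<Omega>\<close> (\<open>dX_wedge_vol_contr\<close>):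

    \<^item> a contact form evaluated at \<open>q\<close> on a vector horizontal at \<open>p\<close> only sees the difference of the
      jet coordinates of \<open>p\<close> and \<open>q\<close>, so \<open>C\<^sub>q(h\<^sub>1, \<dots>, h\<^sub>n)\<close> is \<open>\<Omega>(h\<^sub>1, \<dots>, h\<^sub>n)\<close> times \<open>L(q)\<close> plus terms
      with a factor that vanishes at \<open>q = p\<close> (\<open>lepage_horizontal\<close>);
    \<^item> \<open>C\<^sub>q(w, \<dots>)\<close> is a combination of the \<open>\<Omega>\<^sub>j\<close> with coefficients \<open>\<rho>\<close>, \<open>\<sigma>\<close>, and derivatives along
      horizontal vectors are combinations of total derivatives (\<open>lepage_vertical\<close>, \<open>along_hor_part\<close>).

  Hence the horizontalised contraction is \<open>\<Omega>\<close> times the explicit first variation \<open>variation\<close>, which is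
  linear in \<open>\<eta>\<close> and its total derivatives of order one and two
  (\<open>hor_contract_ext_d_lepage\<close>). The coefficients of the derivatives vanish exactly when the relations
  between \<open>L\<close>, \<open>\<rho>\<close> and \<open>\<sigma>\<close> hold; that they must vanish is seen by inserting fields \<open>\<eta>\<close> whose only nonzero
  component is \<open>X\<^sup>l - X\<^sup>l(p)\<close> or \<open>(X\<^sup>l - X\<^sup>l(p)) (X\<^sup>m - X\<^sup>m(p))\<close>, for each of which exactly one
  multi-index of order at most two has a nonzero total derivative at \<open>p\<close>
  (\<open>variation_algebraic_imp_relations\<close>).

  Under the relations the coefficient of \<open>\<eta>\<^sup>\<alpha>\<close> is \<open>\<partial>\<^sub>\<alpha> L - d\<^sub>j \<rho>\<^sup>j\<close>. Substituting \<open>\<rho>\<close> leaves,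
  besides derivatives of \<open>L\<close>, the sum of \<open>d\<^sub>k d\<^sub>j \<sigma>\<^sup>k\<^sup>j\<close>, in which only the symmetric part of \<open>\<sigma>\<close> matters because total derivatives commute
  (\<open>total_deriv_commute\<close>, a consequence of Schwarz's theorem \<open>mixed_partials_eq\<close>). Collected by unordered
  pairs of indices, the coefficients are second derivatives of \<open>L\<close>, and the Euler-Lagrange expression results
  (\<open>variational_deriv_relations\<close>). The boundary statements are evaluations of \<open>C\<^sub>p(w, \<dots>)\<close>: on vectors
  annihilated by \<open>dX\<^sup>r\<close> every \<open>\<Omega>\<^sub>i\<close> with \<open>i \<noteq> r\<close> is zero (\<open>vol_contr_bdry\<close>).
\<close>


section \<open>Alternating sums and volume forms\<close>

text \<open>
  Both the exterior derivative and the wedge product with a one-form have this shape. The recursion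
  \<open>alt_sum_Cons\<close> replaces the combinatorics of shuffles by induction on the list of arguments.
\<close>

definition alt_sum :: "('v \<Rightarrow> 'v list \<Rightarrow> real) \<Rightarrow> 'v list \<Rightarrow> real" where
  "alt_sum g vs = (\<Sum>i<length vs. (-1) ^ i * g (vs ! i) (nths vs (- {i})))"

lemma alt_sum_Nil [simp]: "alt_sum g [] = 0"
  by (simp add: alt_sum_def)

lemma alt_sum_Cons: "alt_sum g (v # vs) = g v vs - alt_sum (\<lambda>u ws. g u (v # ws)) vs"
proof -
  have "{j. Suc j \<noteq> Suc i} = - {i}" for i by auto
  then show ?thesis
    by (simp add: alt_sum_def sum.lessThan_Suc_shift nths_Cons sum_negf nths_all del: sum.lessThan_Suc)
qed

lemma alt_sum_cong:
  assumes "\<And>v ws. v \<in> set vs \<Longrightarrow> set ws \<subseteq> set vs \<Longrightarrow> g v ws = h v ws"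
  shows "alt_sum g vs = alt_sum h vs"
  unfolding alt_sum_def by (intro sum.cong refl) (auto intro!: assms dest: in_set_nthsD)

lemma alt_sum_sum: "alt_sum (\<lambda>v ws. \<Sum>i\<in>A. g i v ws) vs = (\<Sum>i\<in>A. alt_sum (g i) vs)"
  unfolding alt_sum_def by (simp add: sum_distrib_left) (rule sum.swap)

lemma alt_sum_diff: "alt_sum (\<lambda>v ws. g v ws - h v ws) vs = alt_sum g vs - alt_sum h vs"
  by (simp add: alt_sum_def right_diff_distrib sum_subtractf)

lemma alt_sum_mult: "alt_sum (\<lambda>v ws. c * g v ws) vs = c * alt_sum g vs"
  by (simp add: alt_sum_def sum_distrib_left mult.left_commute)

text \<open>
  Anticommutativity of one-forms, \<open>f \<and> g \<and> w = - g \<and> f \<and> w\<close>: peeling off the first argument yields an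
  expression antisymmetric in \<open>f\<close> and \<open>g\<close> plus the same double sum for the contracted \<open>w\<close>.
\<close>

lemma alt_sum_anticomm:
  "alt_sum (\<lambda>v ws. f v * alt_sum (\<lambda>u us. g u * w us) ws) vs =
   - alt_sum (\<lambda>v ws. g v * alt_sum (\<lambda>u us. f u * w us) ws) vs"
proof (induction vs arbitrary: w)
  case (Cons v vs)
  have step: "alt_sum (\<lambda>v ws. f v * alt_sum (\<lambda>u us. g u * w us) ws) (v # vs) =
      f v * alt_sum (\<lambda>u us. g u * w us) vs - g v * alt_sum (\<lambda>u us. f u * w us) vs
      + alt_sum (\<lambda>u ws. f u * alt_sum (\<lambda>u us. g u * w (v # us)) ws) vs" for f g
    by (simp add: alt_sum_Cons right_diff_distrib alt_sum_diff mult.left_commute[of _ "g v"] alt_sum_mult)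
  show ?case
    unfolding step[of f g] step[of g f] by (subst Cons.IH) simp
qed simp

text \<open>
  In each summand the vector \<open>u\<close> is either the argument of \<open>f\<close> or among the arguments of \<open>w\<close>.
\<close>

lemma alt_sum_eq_0:
  assumes "u \<in> set vs" "f u = 0" "\<And>ws. u \<in> set ws \<Longrightarrow> w ws = 0"
  shows "alt_sum (\<lambda>v ws. f v * w ws) vs = 0"
  using assms(1,3)
proof (induction vs arbitrary: w)
  case (Cons v vs)
  show ?case
  proof (cases "u = v")
    case True
    then show ?thesis using assms(2) Cons.prems(2)
      by (simp add: alt_sum_Cons) (simp add: alt_sum_def)
  next
    case False
    then show ?thesis using Cons.prems Cons.IH[of "\<lambda>ws. w (v # ws)"]
      by (simp add: alt_sum_Cons)
  qed
qed simp

text \<open>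
  A one-form vanishes on all lists but singletons, so only the shuffles with a singleton left part survive;
  the shuffle that moves position \<open>i\<close> to the front has \<open>i\<close> inversions.
\<close>

lemma wedge_one_form:
  assumes "\<And>us. length us \<noteq> 1 \<Longrightarrow> a p us = 0"
  shows "(a \<and>\<^sub>e b) p vs = alt_sum (\<lambda>v ws. a p [v] * b p ws) vs"
proof -
  let ?n = "length vs"
  define t where "t S = (-1) ^ card {(i, j). i \<in> S \<and> j \<in> {..<?n} - S \<and> j < i} *
        a p (nths vs S) * b p (nths vs (- S))" for S
  have zero: "t S = 0" if "S \<in> Pow {..<?n} - (\<lambda>i. {i}) ` {..<?n}" for S
  proof -
    have "{i. i < ?n \<and> i \<in> S} = S" using that by auto
    then have "length (nths vs S) = card S" by (simp add: length_nths)
    moreover have "card S \<noteq> 1"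
      using that by (auto simp: card_1_singleton_iff)
    ultimately show ?thesis by (simp add: t_def assms)
  qed
  have single: "t {i} = (-1) ^ i * (a p [vs ! i] * b p (nths vs (- {i})))" if "i < ?n" for i
  proof -
    have "{(k, j). k \<in> {i} \<and> j \<in> {..<?n} - {i} \<and> j < k} = Pair i ` {..<i}"
      using that by auto
    then have "card {(k, j). k \<in> {i} \<and> j \<in> {..<?n} - {i} \<and> j < k} = i"
      by (simp add: card_image inj_on_def)
    moreover have "nths vs {i} = [vs ! i]"
      using that
    proof (induction vs arbitrary: i)
      case (Cons v vs)
      have e: "{j. Suc j = Suc m} = {m}" for m by auto
      show ?case
        using Cons by (cases i) (simp_all add: nths_Cons e)
    qed simp
    ultimately show ?thesis by (simp add: t_def)
  qed
  have "(a \<and>\<^sub>e b) p vs = (\<Sum>S\<in>Pow {..<?n}. t S)"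
    by (simp add: wedge_def t_def)
  also have "\<dots> = (\<Sum>S\<in>(\<lambda>i. {i}) ` {..<?n}. t S)"
    by (rule sum.mono_neutral_right) (use zero in auto)
  also have "\<dots> = (\<Sum>i<?n. t {i})"
    by (subst sum.reindex) (auto simp: inj_on_def)
  also have "\<dots> = alt_sum (\<lambda>v ws. a p [v] * b p ws) vs"
    by (simp add: alt_sum_def single)
  finally show ?thesis .
qed

lemma wedge_dcoord:
  "(dcoord c \<and>\<^sub>e b) p vs = alt_sum (\<lambda>v ws. v c * b p ws) vs"
  by (subst wedge_one_form) (auto simp: dcoord_def split: list.splits)

text \<open>
  \<open>vol\<close> for an arbitrary list of base indices, to make inductions over the list possible.
\<close>

definition base_wedge :: "'r list \<Rightarrow> ('r, 'm) form" where
  "base_wedge xs = foldr (\<lambda>i a. dcoord (Base i) \<and>\<^sub>e a) xs (fun_form (\<lambda>_. 1))"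

lemma base_wedge_Nil: "base_wedge [] p vs = (if vs = [] then 1 else 0)"
  by (simp add: base_wedge_def fun_form_def)

lemma base_wedge_Cons:
  "base_wedge (x # xs) p vs = alt_sum (\<lambda>v ws. v (Base x) * base_wedge xs p ws) vs"
  by (simp add: base_wedge_def wedge_dcoord)

lemma base_wedge_vertical:
  assumes "u \<in> set vs" "\<And>i. u (Base i) = 0"
  shows "base_wedge xs p vs = 0"
  using assms(1)
proof (induction xs arbitrary: vs)
  case Nil
  then show ?case by (auto simp: base_wedge_Nil)
next
  case (Cons x xs)
  then show ?case
    unfolding base_wedge_Cons using assms(2) by (intro alt_sum_eq_0[of u]) auto
qed

lemma base_wedge_annihilated:
  assumes "i \<in> set xs" "\<And>v. v \<in> set vs \<Longrightarrow> v (Base i) = 0"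
  shows "base_wedge xs p vs = 0"
  using assms
proof (induction xs arbitrary: vs)
  case (Cons x xs)
  have "alt_sum (\<lambda>v ws. v (Base x) * base_wedge xs p ws) vs = alt_sum (\<lambda>v ws. 0) vs"
  proof (rule alt_sum_cong)
    fix v ws assume *: "v \<in> set vs" "set ws \<subseteq> set vs"
    show "v (Base x) * base_wedge xs p ws = 0"
    proof (cases "x = i")
      case True then show ?thesis using * Cons.prems by simp
    next
      case False
      then have "base_wedge xs p ws = 0" using * Cons.prems by (intro Cons.IH) auto
      then show ?thesis by simp
    qed
  qed
  then show ?case by (simp add: base_wedge_Cons) (simp add: alt_sum_def)
qed simp

lemma alt_sum_map: "alt_sum g (map f vs) = alt_sum (\<lambda>v ws. g (f v) (map f ws)) vs"
  by (simp add: alt_sum_def nths_map)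

lemma base_wedge_base_part:
  assumes "\<And>v i. f v (Base i) = v (Base i)"
  shows "base_wedge xs p (map f vs) = base_wedge xs q vs"
proof (induction xs arbitrary: vs)
  case (Cons x xs)
  then show ?case by (simp add: base_wedge_Cons alt_sum_map assms)
qed (simp add: base_wedge_Nil)

text \<open>
  A repeated factor makes the wedge product vanish: the factor \<open>dX\<^sup>i\<close> is moved inwards to its second
  occurrence, where anticommutativity makes the product equal to its own negative.
\<close>

lemma dX_wedge_base_wedge:
  assumes "i \<in> set xs"
  shows "alt_sum (\<lambda>v ws. v (Base i) * base_wedge xs p ws) vs = 0"
  using assms
proof (induction xs arbitrary: vs)
  case (Cons x xs)
  have anti: "alt_sum (\<lambda>v ws. v (Base i) * base_wedge (x # xs) p ws) vs =
      - alt_sum (\<lambda>v ws. v (Base x) * alt_sum (\<lambda>v ws. v (Base i) * base_wedge xs p ws) ws) vs"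
    unfolding base_wedge_Cons by (rule alt_sum_anticomm)
  show ?case
  proof (cases "i = x")
    case True
    with anti show ?thesis by (simp add: base_wedge_Cons)
  next
    case False
    then have "i \<in> set xs" using Cons.prems by simp
    then show ?thesis unfolding anti by (simp add: Cons.IH) (simp add: alt_sum_def)
  qed
qed simp

definition base_vec :: "'r \<Rightarrow> ('r, 'm) tangent" where
  "base_vec i = (\<lambda>c. if c = Base i then 1 else 0)"

lemma base_wedge_basis:
  fixes p :: "('r, 'm) jet"
  assumes "distinct xs"
  shows "base_wedge xs p (map base_vec xs) = 1"
  using assms
proof (induction xs)
  case (Cons x xs)
  have "alt_sum (\<lambda>u ws. u (Base x) * base_wedge xs p (base_vec x # ws)) (map base_vec xs) =
      alt_sum (\<lambda>u ws. 0) (map base_vec xs :: ('r, 'm) tangent list)"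
    by (rule alt_sum_cong) (use Cons.prems in \<open>auto simp: base_vec_def\<close>)
  also have "\<dots> = 0" by (simp add: alt_sum_def)
  finally show ?case
    using Cons by (simp add: base_wedge_Cons alt_sum_Cons) (simp add: base_vec_def)
qed (simp add: base_wedge_Nil)

lemma vol_base_wedge: "vol = base_wedge (sorted_list_of_set UNIV)"
  by (simp add: vol_def base_wedge_def)

lemma vol_contr_apply: "vol_contr j p vs = vol p (base_vec j # vs)"
  by (simp add: vol_contr_def contract_def base_vec_def)

lemma vol_vertical: "u \<in> set vs \<Longrightarrow> (\<And>i. u (Base i) = 0) \<Longrightarrow> vol p vs = 0"
  unfolding vol_base_wedge by (rule base_wedge_vertical)

lemma vol_point: "vol p vs = vol q vs"
  unfolding vol_base_wedge using base_wedge_base_part[of "\<lambda>v. v" _ p vs q] by simp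

lemma vol_contr_point: "vol_contr j p vs = vol_contr j q vs"
  unfolding vol_contr_apply by (rule vol_point)

lemma vol_hor: "vol p (map (hor_part p) vs) = vol p vs"
  unfolding vol_base_wedge by (rule base_wedge_base_part) (simp add: hor_part_def)

lemma vol_nonzero: "\<exists>vs. vol p vs \<noteq> 0"
  using base_wedge_basis[of "sorted_list_of_set UNIV" p]
  by (metis distinct_sorted_list_of_set vol_base_wedge zero_neq_one)

lemma vol_contr_bdry:
  assumes "\<And>v. v \<in> set vs \<Longrightarrow> v (Base l) = 0" "j \<noteq> l"
  shows "vol_contr j p vs = 0"
  unfolding vol_contr_apply vol_base_wedge
  by (rule base_wedge_annihilated[of l]) (use assms in \<open>auto simp: base_vec_def\<close>)

text \<open>
  \<open>dX\<^sup>i \<and> \<Omega>\<^sub>j = \<delta>\<^sub>i\<^sub>j \<Omega>\<close>, obtained by contracting \<open>dX\<^sup>i \<and> \<Omega> = 0\<close> with \<open>\<partial>\<^sub>j\<close>.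
\<close>

lemma dX_wedge_vol_contr:
  "alt_sum (\<lambda>v ws. v (Base i) * vol_contr j p ws) vs = (if i = j then vol p vs else 0)"
proof -
  have "alt_sum (\<lambda>v ws. v (Base i) * vol p ws) (base_vec j # vs) = 0"
    unfolding vol_base_wedge by (rule dX_wedge_base_wedge) simp
  then show ?thesis
    by (auto simp: alt_sum_Cons vol_contr_apply) (auto simp: base_vec_def)
qed

lemma contact_form_length: "length us \<noteq> 1 \<Longrightarrow> contact_form \<alpha> J p us = 0"
  by (auto simp: contact_form_def sum_form_apply scale_form_def dcoord_def split: list.splits)

lemma contact_form_single:
  "contact_form \<alpha> J p [v] = v (Fib \<alpha> J) - (\<Sum>i\<in>UNIV. p (Fib \<alpha> (J + unit_mi i)) * v (Base i))"
  by (simp add: contact_form_def sum_form_apply scale_form_def dcoord_def)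

lemma contact_wedge_vol_contr:
  "(contact_form \<alpha> J \<and>\<^sub>e vol_contr j) p vs =
     alt_sum (\<lambda>v ws. contact_form \<alpha> J p [v] * vol_contr j p ws) vs"
  by (rule wedge_one_form) (rule contact_form_length)

lemma contact_wedge_vertical:
  assumes "\<And>i. w (Base i) = 0"
  shows "(contact_form \<alpha> J \<and>\<^sub>e vol_contr j) q (w # ws) = w (Fib \<alpha> J) * vol_contr j p ws"
proof -
  have "vol_contr j q (w # us) = 0" for us
    unfolding vol_contr_apply by (rule vol_vertical[of w]) (use assms in auto)
  then show ?thesis
    unfolding contact_wedge_vol_contr alt_sum_Cons
    by (simp add: contact_form_single assms vol_contr_point[of j q _ p]) (simp add: alt_sum_def)
qed

text \<open>
  The form is taken at \<open>q\<close> but the arguments are horizontal at \<open>p\<close>. On such a vector \<open>u\<close> the contact form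
  is the sum over \<open>i\<close> of the coordinate differences at \<open>J + 1\<^sub>i\<close> times \<open>dX\<^sup>i(u)\<close>, and the product with
  \<open>\<Omega>\<^sub>j\<close> keeps \<open>i = j\<close> only. Having the dependence on \<open>q\<close> explicit allows differentiation in \<open>q\<close> at \<open>p\<close>.
\<close>

lemma contact_wedge_horizontal:
  "(contact_form \<alpha> J \<and>\<^sub>e vol_contr j) q (map (hor_part p) vs) =
     (p (Fib \<alpha> (J + unit_mi j)) - q (Fib \<alpha> (J + unit_mi j))) * vol p vs"
proof -
  let ?h = "map (hor_part p) vs"
  let ?d = "\<lambda>i. p (Fib \<alpha> (J + unit_mi i)) - q (Fib \<alpha> (J + unit_mi i))"
  have "(contact_form \<alpha> J \<and>\<^sub>e vol_contr j) q ?h =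
      alt_sum (\<lambda>v ws. \<Sum>i\<in>UNIV. ?d i * (v (Base i) * vol_contr j q ws)) ?h"
    unfolding contact_wedge_vol_contr
  proof (rule alt_sum_cong)
    fix v ws assume "v \<in> set ?h"
    then obtain u where "v = hor_part p u" by auto
    then have "contact_form \<alpha> J q [v] = (\<Sum>i\<in>UNIV. ?d i * v (Base i))"
      by (simp add: contact_form_single hor_part_def left_diff_distrib sum_subtractf)
    then show "contact_form \<alpha> J q [v] * vol_contr j q ws =
        (\<Sum>i\<in>UNIV. ?d i * (v (Base i) * vol_contr j q ws))"
      by (simp add: sum_distrib_right mult.assoc)
  qed
  also have "\<dots> = (\<Sum>i\<in>UNIV. ?d i * (if i = j then vol q ?h else 0))"
    by (simp add: alt_sum_sum alt_sum_mult dX_wedge_vol_contr)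
  also have "\<dots> = ?d j * vol q ?h"
    by (simp add: if_distrib cong: if_cong)
  also have "vol q ?h = vol p vs"
    by (simp add: vol_point[of q _ p] vol_hor)
  finally show ?thesis .
qed

section \<open>Smooth functions on jets\<close>

lemma open_jets_over:
  assumes "open V"
  shows "open (jets_over V :: ('r::finite, 'm::finite) jet set)"
proof -
  have "continuous_on UNIV (\<lambda>p :: ('r, 'm) jet. ((\<chi> i. p (Base i)), (\<chi> \<alpha>. p (Fib \<alpha> 0))))"
    by (intro continuous_on_Pair continuous_on_vec_lambda continuous_on_product_coordinates)
  from open_vimage[OF assms this] show ?thesis
    by (simp add: jets_over_def vimage_def)
qed

lemma continuous_on_update2: "continuous_on UNIV (\<lambda>z :: real \<times> real. (p :: 'c \<Rightarrow> real)(c := fst z, c' := snd z))"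
proof (rule continuous_on_coordinatewise_then_product)
  fix i
  show "continuous_on UNIV (\<lambda>z :: real \<times> real. (p(c := fst z, c' := snd z)) i)"
    by (cases "i = c'"; cases "i = c") (auto intro!: continuous_intros)
qed

lemma eventually_jets_over:
  assumes "open V" "p \<in> jets_over V"
  shows "eventually (\<lambda>t. p(c := t) \<in> jets_over V) (nhds (p c))"
proof -
  have "continuous_on UNIV (\<lambda>t. p(c := t))"
  proof (rule continuous_on_coordinatewise_then_product)
    fix i show "continuous_on UNIV (\<lambda>t. (p(c := t)) i)"
      by (cases "i = c") (auto intro!: continuous_intros)
  qed
  from open_vimage[OF open_jets_over[OF assms(1)] this]
  show ?thesis using assms(2)
    by (auto simp: eventually_nhds intro!: exI[of _ "(\<lambda>t. p(c := t)) -` jets_over V"])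
qed

lemma pd_cong:
  assumes "open V" "p \<in> jets_over V" "\<And>q. q \<in> jets_over V \<Longrightarrow> F q = G q"
  shows "pd c F p = pd c G p"
  unfolding pd_def
  by (rule deriv_cong_ev[OF eventually_mono[OF eventually_jets_over[OF assms(1,2)]] refl])
    (rule assms(3))

lemma smooth_jet_has_order: "smooth_jet V n F \<Longrightarrow> has_order V n F"
  by (simp add: smooth_jet_def)

lemma smooth_jet_continuous: "smooth_jet V n F \<Longrightarrow> continuous_on (jets_over V) F"
  using spec[of "\<lambda>cs. continuous_on (jets_over V) (foldr pd cs F)" "[]"]
  by (simp add: smooth_jet_def)

lemma smooth_jet_DERIV:
  assumes "smooth_jet V n F" "p \<in> jets_over V"
  shows "((\<lambda>t. F (p(c := t))) has_real_derivative pd c F p) (at (p c))"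
proof -
  have "(\<lambda>t. foldr pd [] F (p(c := t))) differentiable (at (p c))"
    using assms unfolding smooth_jet_def by blast
  then show ?thesis
    by (simp add: pd_def) (metis DERIV_deriv_iff_real_differentiable)
qed

text \<open>
  For a coordinate above the order the derivative is zero at every point. For a coordinate within the order
  the two difference quotients agree once the moved points are both over \<open>V\<close>, which holds for small steps.
\<close>

lemma has_order_pd:
  assumes "open V" "has_order V n F"
  shows "has_order V n (pd c F)"
  unfolding has_order_def
proof (intro ballI impI)
  fix p q :: "('a, 'b) jet"
  assume V: "p \<in> jets_over V" "q \<in> jets_over V"
    and eq: "(\<forall>i. p (Base i) = q (Base i)) \<and>
        (\<forall>\<alpha> J. mi_len J \<le> n \<longrightarrow> p (Fib \<alpha> J) = q (Fib \<alpha> J))"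
  note F = assms(2)[unfolded has_order_def, rule_format]
  show "pd c F p = pd c F q"
  proof (cases "\<exists>\<alpha> J. c = Fib \<alpha> J \<and> n < mi_len J")
    case True
    then obtain \<alpha> J where c: "c = Fib \<alpha> J" "n < mi_len J" by blast
    have "pd c F p' = 0" if "p' \<in> jets_over V" for p'
    proof -
      have "deriv (\<lambda>t. F (p'(c := t))) (p' c) = deriv (\<lambda>t. F p') (p' c)"
        by (rule deriv_cong_ev[OF eventually_mono[OF eventually_jets_over[OF assms(1) that]] refl])
          (rule F, use that c in auto)
      then show ?thesis by (simp add: pd_def)
    qed
    then show ?thesis using V by simp
  next
    case False
    then have c: "p c = q c" using eq by (cases c) (auto simp: not_less)
    have "eventually (\<lambda>t. p(c := t) \<in> jets_over V \<and> q(c := t) \<in> jets_over V) (nhds (p c))"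
      using eventually_jets_over[OF assms(1) V(1), of c] eventually_jets_over[OF assms(1) V(2), of c]
      by (simp add: c eventually_conj)
    then have "eventually (\<lambda>t. F (p(c := t)) = F (q(c := t))) (nhds (p c))"
      by (rule eventually_mono) (rule F, use eq in auto)
    then show ?thesis unfolding pd_def by (rule deriv_cong_ev) (rule c)
  qed
qed

lemma pd_above_order:
  assumes "open V" "has_order V n F" "p \<in> jets_over V" "n < mi_len J"
  shows "pd (Fib \<alpha> J) F p = 0"
proof -
  have "deriv (\<lambda>t. F (p((Fib \<alpha> J) := t))) (p (Fib \<alpha> J)) = deriv (\<lambda>t. F p) (p (Fib \<alpha> J))"
    by (rule deriv_cong_ev[OF eventually_mono[OF eventually_jets_over[OF assms(1,3)]] refl])
      (rule assms(2)[unfolded has_order_def, rule_format], use assms in auto)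
  then show ?thesis by (simp add: pd_def)
qed

lemma smooth_jet_pd:
  assumes "open V" "smooth_jet V n F"
  shows "smooth_jet V n (pd c F)"
proof -
  have "foldr pd cs (pd c F) = foldr pd (cs @ [c]) F" for cs by simp
  then show ?thesis
    using assms has_order_pd[OF assms(1)] unfolding smooth_jet_def by metis
qed

lemma smooth_jet_mono: "smooth_jet V m F \<Longrightarrow> m \<le> n \<Longrightarrow> smooth_jet V n F"
  unfolding smooth_jet_def has_order_def by (meson order_trans)

text \<open>
  Iterated derivatives at jets over the open set \<open>V\<close> only depend on values over \<open>V\<close>, hence a class of
  functions that is closed under partial derivatives up to equality over \<open>V\<close> is followed through any
  number of derivatives without leaving it.
\<close>

lemma smooth_jet_coinduct:
  assumes V: "open V" and F: "F \<in> K" "has_order V n F"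
    and cont: "\<And>G. G \<in> K \<Longrightarrow> continuous_on (jets_over V) G"
    and diff: "\<And>G c p. G \<in> K \<Longrightarrow> p \<in> jets_over V \<Longrightarrow> (\<lambda>t. G (p(c := t))) differentiable (at (p c))"
    and step: "\<And>G c. G \<in> K \<Longrightarrow> \<exists>H\<in>K. \<forall>p\<in>jets_over V. pd c G p = H p"
  shows "smooth_jet V n F"
proof -
  have ex: "\<exists>H\<in>K. \<forall>p\<in>jets_over V. foldr pd cs F p = H p" for cs
  proof (induction cs)
    case Nil
    then show ?case using F by auto
  next
    case (Cons c cs)
    then obtain G where G: "G \<in> K" "\<forall>p\<in>jets_over V. foldr pd cs F p = G p" by blast
    from step[OF G(1), of c] obtain H where H: "H \<in> K" "\<forall>p\<in>jets_over V. pd c G p = H p" by blast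
    have "foldr pd (c # cs) F p = H p" if "p \<in> jets_over V" for p
      using pd_cong[OF V that, of "foldr pd cs F" G c] G(2) H(2) that by simp
    then show ?case using H(1) by blast
  qed
  show ?thesis
    unfolding smooth_jet_def
  proof (intro conjI allI ballI F)
    fix cs
    obtain H where H: "H \<in> K" "\<forall>p\<in>jets_over V. foldr pd cs F p = H p" using ex by blast
    show "continuous_on (jets_over V) (foldr pd cs F)"
      using cont[OF H(1)] H(2) by (simp cong: continuous_on_cong)
    fix c p assume p: "p \<in> jets_over V"
    have "(\<lambda>t. H (p(c := t))) differentiable (at (p c))" using diff[OF H(1) p] .
    then obtain D where D: "((\<lambda>t. H (p(c := t))) has_real_derivative D) (at (p c))"
      by (auto simp: real_differentiable_def)
    have "eventually (\<lambda>t. foldr pd cs F (p(c := t)) = H (p(c := t))) (nhds (p c))"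
      using eventually_jets_over[OF V p] by (rule eventually_mono) (use H in auto)
    from DERIV_cong_ev[OF refl this refl] D
    show "(\<lambda>t. foldr pd cs F (p(c := t))) differentiable (at (p c))"
      by (auto simp: real_differentiable_def)
  qed
qed

lemma pd_const [simp]: "pd c (\<lambda>q. a) p = 0"
  by (simp add: pd_def)

lemma pd_coord: "pd c (\<lambda>q. q c') p = (if c = c' then 1 else 0)"
  by (simp add: pd_def)

lemma smooth_jet_const:
  assumes "open V"
  shows "smooth_jet V n (\<lambda>q. a)"
  by (rule smooth_jet_coinduct[where K = "range (\<lambda>a q. a)"])
    (use assms in \<open>auto simp: has_order_def pd_def\<close>)

lemma smooth_jet_coord:
  fixes c :: "('r::finite, 'm::finite) coord"
  assumes "open V" "\<And>\<alpha> J. c = Fib \<alpha> J \<Longrightarrow> mi_len J \<le> n"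
  shows "smooth_jet V n (\<lambda>q. q c)"
proof (rule smooth_jet_coinduct[where K = "insert (\<lambda>q. q c) (range (\<lambda>a q. a))"])
  show "has_order V n (\<lambda>q. q c)"
    using assms(2) by (cases c) (auto simp: has_order_def)
  fix G :: "('r, 'm) jfun" and c' and p :: "('r, 'm) jet"
  assume G: "G \<in> insert (\<lambda>q. q c) (range (\<lambda>a q. a))"
  show "continuous_on (jets_over V) G"
    using G by (auto intro: continuous_on_product_coordinates continuous_on_subset)
  show "(\<lambda>t. G (p(c' := t))) differentiable (at (p c'))"
    using G by (cases "c' = c") auto
  show "\<exists>H\<in>insert (\<lambda>q. q c) (range (\<lambda>a q. a)). \<forall>p\<in>jets_over V. pd c' G p = H p"
    using G by (auto simp: pd_coord)
qed (use assms in auto)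

text \<open>
  The polynomials in smooth functions are closed under partial derivatives by the sum and product rules.
  Thus \<open>smooth_jet_coinduct\<close> yields closure of smoothness under sums and products at one stroke; there is no
  need for formulas for iterated derivatives of a product. The orders of the generators may differ; order
  is a separate condition in \<open>smooth_gen_smooth\<close>.
\<close>

inductive_set smooth_gen :: "((real^'r) \<times> (real^'m)) set \<Rightarrow> ('r::finite, 'm::finite) jfun set"
  for V where
  base: "smooth_jet V n F \<Longrightarrow> F \<in> smooth_gen V"
| add: "F \<in> smooth_gen V \<Longrightarrow> G \<in> smooth_gen V \<Longrightarrow> (\<lambda>q. F q + G q) \<in> smooth_gen V"
| mult: "F \<in> smooth_gen V \<Longrightarrow> G \<in> smooth_gen V \<Longrightarrow> (\<lambda>q. F q * G q) \<in> smooth_gen V"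

lemma smooth_gen_DERIV:
  assumes "F \<in> smooth_gen V" "p \<in> jets_over V"
  shows "((\<lambda>t. F (p(c := t))) has_real_derivative pd c F p) (at (p c))"
  using assms(1)
proof induction
  case (base n F)
  then show ?case by (rule smooth_jet_DERIV[OF _ assms(2)])
next
  case (add F G)
  note D = DERIV_add[OF add.IH]
  show ?case unfolding pd_def[of c "\<lambda>q. F q + G q"] DERIV_imp_deriv[OF D] by (rule D)
next
  case (mult F G)
  note D = DERIV_mult[OF mult.IH]
  show ?case unfolding pd_def[of c "\<lambda>q. F q * G q"] DERIV_imp_deriv[OF D] by (rule D)
qed

lemma pd_add_gen:
  assumes "F \<in> smooth_gen V" "G \<in> smooth_gen V" "p \<in> jets_over V"
  shows "pd c (\<lambda>q. F q + G q) p = pd c F p + pd c G p"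
  using DERIV_imp_deriv[OF DERIV_add[OF smooth_gen_DERIV[OF assms(1,3)] smooth_gen_DERIV[OF assms(2,3)]]]
  by (simp add: pd_def)

lemma pd_mult_gen:
  assumes "F \<in> smooth_gen V" "G \<in> smooth_gen V" "p \<in> jets_over V"
  shows "pd c (\<lambda>q. F q * G q) p = pd c F p * G p + F p * pd c G p"
  using DERIV_imp_deriv[OF DERIV_mult[OF smooth_gen_DERIV[OF assms(1,3)] smooth_gen_DERIV[OF assms(2,3)]]]
  by (simp add: pd_def mult.commute)

lemma smooth_gen_smooth:
  assumes V: "open V" and F: "F \<in> smooth_gen V" "has_order V n F"
  shows "smooth_jet V n F"
proof (rule smooth_jet_coinduct[where K = "smooth_gen V"])
  fix G c p assume G: "G \<in> smooth_gen V"
  show "continuous_on (jets_over V) G"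
    using G by induction (blast intro: smooth_jet_continuous continuous_on_add continuous_on_mult)+
  show "(\<lambda>t. G (p(c := t))) differentiable (at (p c))" if "p \<in> jets_over V"
    using smooth_gen_DERIV[OF G that] real_differentiable_def by blast
  show "\<exists>H\<in>smooth_gen V. \<forall>p\<in>jets_over V. pd c G p = H p"
    using G
  proof induction
    case (base n F)
    then show ?case using smooth_jet_pd[OF V] smooth_gen.base by metis
  next
    case (add F G)
    then obtain H H' where "H \<in> smooth_gen V" "H' \<in> smooth_gen V"
      "\<forall>p\<in>jets_over V. pd c F p = H p" "\<forall>p\<in>jets_over V. pd c G p = H' p" by blast
    then show ?case
      by (intro bexI[of _ "\<lambda>q. H q + H' q"]) (simp_all add: pd_add_gen[OF add.hyps] smooth_gen.add)
  next
    case (mult F G)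
    then obtain H H' where "H \<in> smooth_gen V" "H' \<in> smooth_gen V"
      "\<forall>p\<in>jets_over V. pd c F p = H p" "\<forall>p\<in>jets_over V. pd c G p = H' p" by blast
    then show ?case
      by (intro bexI[of _ "\<lambda>q. H q * G q + F q * H' q"])
        (simp_all add: pd_mult_gen[OF mult.hyps] smooth_gen.add smooth_gen.mult mult.hyps)
  qed
qed (use assms in auto)

lemma has_order_combine:
  assumes "has_order V n F" "has_order V n G"
  shows "has_order V n (\<lambda>q. h (F q) (G q))"
  unfolding has_order_def
proof (intro ballI impI)
  fix p q
  assume "p \<in> jets_over V" "q \<in> jets_over V" "(\<forall>i. p (Base i) = q (Base i)) \<and>
        (\<forall>\<alpha> J. mi_len J \<le> n \<longrightarrow> p (Fib \<alpha> J) = q (Fib \<alpha> J))"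
  then have "F p = F q" "G p = G q"
    using assms unfolding has_order_def by blast+
  then show "h (F p) (G p) = h (F q) (G q)" by simp
qed

lemma smooth_jet_add:
  assumes "open V" "smooth_jet V n F" "smooth_jet V n G"
  shows "smooth_jet V n (\<lambda>q. F q + G q)"
  by (rule smooth_gen_smooth[OF assms(1) smooth_gen.add[OF assms(2,3)[THEN smooth_gen.base]]
        has_order_combine[OF assms(2,3)[THEN smooth_jet_has_order]]])

lemma smooth_jet_mult:
  assumes "open V" "smooth_jet V n F" "smooth_jet V n G"
  shows "smooth_jet V n (\<lambda>q. F q * G q)"
  by (rule smooth_gen_smooth[OF assms(1) smooth_gen.mult[OF assms(2,3)[THEN smooth_gen.base]]
        has_order_combine[OF assms(2,3)[THEN smooth_jet_has_order]]])

lemma smooth_jet_diff: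
  assumes "open V" "smooth_jet V n F" "smooth_jet V n G"
  shows "smooth_jet V n (\<lambda>q. F q - G q)"
  using smooth_jet_add[OF assms(1,2) smooth_jet_mult[OF assms(1) smooth_jet_const[OF assms(1), of n "-1"] assms(3)]]
  by simp

lemma smooth_jet_sum:
  assumes "open V" "\<And>i. i \<in> A \<Longrightarrow> smooth_jet V n (F i)"
  shows "smooth_jet V n (\<lambda>q. \<Sum>i\<in>A. F i q)"
  using assms(2)
  by (induction A rule: infinite_finite_induct)
    (auto intro: smooth_jet_const smooth_jet_add assms(1))

lemma smooth_jet_cong:
  assumes "open V" "smooth_jet V n F" "\<And>q. q \<in> jets_over V \<Longrightarrow> F q = G q"
  shows "smooth_jet V n G"
proof (rule smooth_jet_coinduct[OF assms(1), where K = "insert G {F. smooth_jet V n F}"])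
  show "has_order V n G"
    using smooth_jet_has_order[OF assms(2)] assms(3) unfolding has_order_def by metis
  fix H c p assume "H \<in> insert G {F. smooth_jet V n F}"
  then obtain H' where H': "smooth_jet V n H'" "\<And>q. q \<in> jets_over V \<Longrightarrow> H' q = H q"
    using assms by blast
  show "continuous_on (jets_over V) H"
    using smooth_jet_continuous[OF H'(1)] H'(2) by (simp cong: continuous_on_cong)
  show "\<exists>K\<in>insert G {F. smooth_jet V n F}. \<forall>p\<in>jets_over V. pd c H p = K p"
    using smooth_jet_pd[OF assms(1) H'(1), of c] pd_cong[OF assms(1), of _ H' H c] H'(2) by auto
  assume p: "p \<in> jets_over V"
  have "eventually (\<lambda>t. H' (p(c := t)) = H (p(c := t))) (nhds (p c))"
    using eventually_jets_over[OF assms(1) p] by (rule eventually_mono) (use H' in auto)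
  from DERIV_cong_ev[OF refl this refl] smooth_jet_DERIV[OF H'(1) p, of c]
  show "(\<lambda>t. H (p(c := t))) differentiable (at (p c))"
    by (auto simp: real_differentiable_def)
qed simp

section \<open>Symmetry of second derivatives\<close>

text \<open>
  Two applications of the mean value theorem, first in \<open>s\<close> and then in \<open>t\<close>.
\<close>

lemma mixed_difference:
  fixes f :: "real \<Rightarrow> real \<Rightarrow> real"
  assumes h: "0 < h" "h < d"
    and fx: "\<And>s t. \<bar>s - a\<bar> < d \<Longrightarrow> \<bar>t - b\<bar> < d \<Longrightarrow> ((\<lambda>s. f s t) has_real_derivative fx s t) (at s)"
    and fxy: "\<And>s t. \<bar>s - a\<bar> < d \<Longrightarrow> \<bar>t - b\<bar> < d \<Longrightarrow> ((\<lambda>t. fx s t) has_real_derivative fxy s t) (at t)"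
  shows "\<exists>s t. a < s \<and> s < a + h \<and> b < t \<and> t < b + h \<and>
           f (a + h) (b + h) - f (a + h) b - f a (b + h) + f a b = h * h * fxy s t"
proof -
  have "\<exists>s. s > a \<and> s < a + h \<and>
      (f (a + h) (b + h) - f (a + h) b) - (f a (b + h) - f a b) = (a + h - a) * (fx s (b + h) - fx s b)"
    by (rule MVT2[where f = "\<lambda>s. f s (b + h) - f s b"]) (use h in \<open>auto intro!: DERIV_diff fx\<close>)
  then obtain s where s: "a < s" "s < a + h"
    "f (a + h) (b + h) - f (a + h) b - f a (b + h) + f a b = h * (fx s (b + h) - fx s b)" by auto
  have "\<exists>t. t > b \<and> t < b + h \<and> fx s (b + h) - fx s b = (b + h - b) * fxy s t"
    by (rule MVT2) (use h s in \<open>auto intro!: fxy\<close>)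
  then show ?thesis using s by auto
qed

text \<open>
  Schwarz's theorem. The second difference over a square of side \<open>h\<close> is symmetric in the two variables, so
  by \<open>mixed_difference\<close> the two mixed derivatives take a common value (at different points) within
  distance \<open>2 h\<close> of the corner; continuity forces equality at the corner.
\<close>

lemma mixed_partials_eq:
  fixes f :: "real \<Rightarrow> real \<Rightarrow> real"
  assumes d: "0 < d"
    and fx: "\<And>s t. \<bar>s - a\<bar> < d \<Longrightarrow> \<bar>t - b\<bar> < d \<Longrightarrow> ((\<lambda>s. f s t) has_real_derivative fx s t) (at s)"
    and fy: "\<And>s t. \<bar>s - a\<bar> < d \<Longrightarrow> \<bar>t - b\<bar> < d \<Longrightarrow> ((\<lambda>t. f s t) has_real_derivative fy s t) (at t)"
    and fxy: "\<And>s t. \<bar>s - a\<bar> < d \<Longrightarrow> \<bar>t - b\<bar> < d \<Longrightarrow> ((\<lambda>t. fx s t) has_real_derivative fxy s t) (at t)"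
    and fyx: "\<And>s t. \<bar>s - a\<bar> < d \<Longrightarrow> \<bar>t - b\<bar> < d \<Longrightarrow> ((\<lambda>s. fy s t) has_real_derivative fyx s t) (at s)"
    and cxy: "isCont (\<lambda>z. fxy (fst z) (snd z)) (a, b)"
    and cyx: "isCont (\<lambda>z. fyx (fst z) (snd z)) (a, b)"
  shows "fxy a b = fyx a b"
proof -
  have "\<bar>fxy a b - fyx a b\<bar> \<le> 0 + e" if e: "e > 0" for e
  proof -
    obtain d1 where d1: "d1 > 0" "\<And>z. dist z (a, b) < d1 \<Longrightarrow> dist (fxy (fst z) (snd z)) (fxy a b) < e / 2"
      using cxy e unfolding continuous_at_eps_delta by (metis fst_conv half_gt_zero snd_conv)
    obtain d2 where d2: "d2 > 0" "\<And>z. dist z (a, b) < d2 \<Longrightarrow> dist (fyx (fst z) (snd z)) (fyx a b) < e / 2"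
      using cyx e unfolding continuous_at_eps_delta by (metis fst_conv half_gt_zero snd_conv)
    \<comment> \<open>Small enough for the square to fit, and for its points to lie within \<open>d1\<close> and \<open>d2\<close> of the corner.\<close>
    define h where "h = Min {d, d1, d2} / 2"
    have h: "0 < h" "h < d" "2 * h \<le> d1" "2 * h \<le> d2"
      using d d1 d2 by (auto simp: h_def)
    obtain s t where st: "a < s" "s < a + h" "b < t" "t < b + h"
      "f (a + h) (b + h) - f (a + h) b - f a (b + h) + f a b = h * h * fxy s t"
      using mixed_difference[OF h(1,2) fx fxy] by blast
    obtain t' s' where st': "b < t'" "t' < b + h" "a < s'" "s' < a + h"
      "f (a + h) (b + h) - f a (b + h) - f (a + h) b + f a b = h * h * fyx s' t'"
      using mixed_difference[OF h(1,2), where f = "\<lambda>t s. f s t" and fx = "\<lambda>t s. fy s t" and fxy = "\<lambda>t s. fyx s t"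
          and a = b and b = a] fy fyx by blast
    have "h * h * fxy s t = h * h * fyx s' t'" using st(5) st'(5) by linarith
    then have eq: "fxy s t = fyx s' t'" using h by simp
    have "dist (x, y) (a, b) < 2 * h" if "a < x" "x < a + h" "b < y" "y < b + h" for x y
    proof -
      have "dist (x, y) (a, b) \<le> \<bar>x - a\<bar> + \<bar>y - b\<bar>"
        using norm_Pair_le[of "x - a" "y - b"] by (simp add: dist_norm)
      then show ?thesis using that by linarith
    qed
    from d1(2)[of "(s, t)"] d2(2)[of "(s', t')"] this[of s t] this[of s' t'] st st' h eq
    show ?thesis by (auto simp: dist_real_def abs_if split: if_splits)
  qed
  then have "\<bar>fxy a b - fyx a b\<bar> \<le> 0" by (rule field_le_epsilon)
  then show ?thesis by simp
qed

lemma pd_commute: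
  assumes V: "open V" and F: "smooth_jet V n F" and p: "p \<in> jets_over V"
  shows "pd c' (pd c F) p = pd c (pd c' F) p"
proof (cases "c = c'")
  case False
  define P where "P s t = p(c := s, c' := t)" for s t
  have cont: "continuous_on UNIV (\<lambda>z. P (fst z) (snd z))"
    unfolding P_def by (rule continuous_on_update2)
  define U where "U = (\<lambda>z. P (fst z) (snd z)) -` jets_over V"
  have "open U" unfolding U_def by (rule open_vimage[OF open_jets_over[OF V] cont])
  moreover have Pp: "P (p c) (p c') = p" by (simp add: P_def)
  then have inU: "(p c, p c') \<in> U" using p by (simp add: U_def)
  ultimately obtain e where e: "e > 0" "ball (p c, p c') e \<subseteq> U"
    using open_contains_ball by blast
  have inV: "P s t \<in> jets_over V" if "\<bar>s - p c\<bar> < e / 2" "\<bar>t - p c'\<bar> < e / 2" for s t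
  proof -
    have "dist (s, t) (p c, p c') \<le> \<bar>s - p c\<bar> + \<bar>t - p c'\<bar>"
      using norm_Pair_le[of "s - p c" "t - p c'"] by (simp add: dist_norm)
    then have "(s, t) \<in> ball (p c, p c') e" using that by (simp add: dist_commute)
    then show ?thesis using e(2) by (auto simp: U_def)
  qed
  have dx: "((\<lambda>s. G (P s t)) has_real_derivative pd c G (P s t)) (at s)"
    if "smooth_jet V n G" "P s t \<in> jets_over V" for G s t
    using smooth_jet_DERIV[OF that, of c] False by (simp add: P_def fun_upd_twist)
  have dy: "((\<lambda>t. G (P s t)) has_real_derivative pd c' G (P s t)) (at t)"
    if "smooth_jet V n G" "P s t \<in> jets_over V" for G s t
    using smooth_jet_DERIV[OF that, of c'] by (simp add: P_def)
  have cG: "isCont (\<lambda>z. G (P (fst z) (snd z))) (p c, p c')" if "smooth_jet V n G" for G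
  proof -
    have "continuous_on U (\<lambda>z. G (P (fst z) (snd z)))"
      by (rule continuous_on_compose2[OF smooth_jet_continuous[OF that]
            continuous_on_subset[OF cont]]) (auto simp: U_def)
    then show ?thesis using inU \<open>open U\<close> by (simp add: continuous_on_eq_continuous_at)
  qed
  note sm = smooth_jet_pd[OF V]
  have "pd c' (pd c F) (P (p c) (p c')) = pd c (pd c' F) (P (p c) (p c'))"
    by (rule mixed_partials_eq[where d = "e / 2" and f = "\<lambda>s t. F (P s t)"])
      (use e in \<open>auto intro!: dx dy cG sm F inV\<close>)
  then show ?thesis by (simp add: Pp)
qed simp

section \<open>Directional and total derivatives\<close>

text \<open>
  The derivative in the direction of a tangent vector. The exterior derivative, total derivatives and the
  action of a prolonged vertical field are all instances, so the Leibniz rule is needed only once.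
\<close>

definition along :: "('r, 'm) tangent \<Rightarrow> ('r, 'm) jfun \<Rightarrow> ('r, 'm) jfun" where
  "along v F p = Sum_any (\<lambda>c. v c * pd c F p)"

text \<open>
  The coordinates of the jet manifold of order \<open>n\<close>: a finite index set that can replace the support in
  \<open>along\<close>.
\<close>

definition jet_coords :: "nat \<Rightarrow> ('r::finite, 'm::finite) coord set" where
  "jet_coords n = range Base \<union> (\<lambda>(\<alpha>, J). Fib \<alpha> J) ` (UNIV \<times> {J. mi_len J \<le> n})"

lemma finite_jet_coords: "finite (jet_coords n)"
  by (auto simp: jet_coords_def finite_mi_len_le)

lemma sum_jet_coords:
  "(\<Sum>c\<in>jet_coords n. f c) = (\<Sum>i\<in>UNIV. f (Base i)) + (\<Sum>\<alpha>\<in>UNIV. \<Sum>J | mi_len J \<le> n. f (Fib \<alpha> J))"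
proof -
  have "(\<Sum>c\<in>jet_coords n. f c) = (\<Sum>c\<in>range Base. f c) +
      (\<Sum>c\<in>(\<lambda>(\<alpha>, J). Fib \<alpha> J) ` (UNIV \<times> {J. mi_len J \<le> n}). f c)"
    unfolding jet_coords_def by (rule sum.union_disjoint) (auto simp: finite_mi_len_le)
  also have "(\<Sum>c\<in>range Base. f c) = (\<Sum>i\<in>UNIV. f (Base i))"
    by (subst sum.reindex) (auto simp: inj_on_def)
  also have "(\<Sum>c\<in>(\<lambda>(\<alpha>, J). Fib \<alpha> J) ` (UNIV \<times> {J. mi_len J \<le> n}). f c) =
      (\<Sum>(\<alpha>, J)\<in>UNIV \<times> {J. mi_len J \<le> n}. f (Fib \<alpha> J))"
    by (subst sum.reindex) (auto simp: inj_on_def intro!: sum.cong)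
  also have "\<dots> = (\<Sum>\<alpha>\<in>UNIV. \<Sum>J | mi_len J \<le> n. f (Fib \<alpha> J))"
    by (rule sum.cartesian_product[symmetric])
  finally show ?thesis .
qed

lemma along_sum_coords:
  assumes "open V" "has_order V n F" "p \<in> jets_over V"
  shows "along v F p = (\<Sum>c\<in>jet_coords n. v c * pd c F p)"
  unfolding along_def
proof (rule Sum_any.expand_superset[OF finite_jet_coords], rule subsetI)
  fix c assume "c \<in> {c. v c * pd c F p \<noteq> 0}"
  then have nz: "pd c F p \<noteq> 0" by auto
  show "c \<in> jet_coords n"
  proof (cases c)
    case (Base i)
    then show ?thesis by (simp add: jet_coords_def)
  next
    case (Fib \<alpha> J)
    then have "mi_len J \<le> n" using pd_above_order[OF assms] nz by (metis not_le)
    then show ?thesis using Fib by (auto simp: jet_coords_def)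
  qed
qed

lemma along_add:
  assumes "open V" "smooth_jet V n F" "smooth_jet V n G" "p \<in> jets_over V"
  shows "along v (\<lambda>q. F q + G q) p = along v F p + along v G p"
proof -
  note o = assms(2,3)[THEN smooth_jet_has_order] smooth_jet_has_order[OF smooth_jet_add[OF assms(1-3)]]
  show ?thesis
    unfolding o[THEN along_sum_coords[OF assms(1) _ assms(4)]]
    by (simp add: pd_add_gen[OF assms(2,3)[THEN smooth_gen.base] assms(4)] distrib_left sum.distrib)
qed

lemma along_mult:
  assumes "open V" "smooth_jet V n F" "smooth_jet V n G" "p \<in> jets_over V"
  shows "along v (\<lambda>q. F q * G q) p = along v F p * G p + F p * along v G p"
proof -
  note o = assms(2,3)[THEN smooth_jet_has_order] smooth_jet_has_order[OF smooth_jet_mult[OF assms(1-3)]]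
  show ?thesis
    unfolding o[THEN along_sum_coords[OF assms(1) _ assms(4)]]
    by (simp add: pd_mult_gen[OF assms(2,3)[THEN smooth_gen.base] assms(4)] distrib_left sum.distrib
        sum_distrib_left sum_distrib_right mult_ac)
qed

lemma along_const [simp]: "along v (\<lambda>q. a) p = 0"
  by (simp add: along_def)

lemma along_cmult:
  assumes "open V" "smooth_jet V n F" "p \<in> jets_over V"
  shows "along v (\<lambda>q. a * F q) p = a * along v F p"
  using along_mult[OF assms(1) smooth_jet_const[OF assms(1)] assms(2,3)] by simp

lemma along_diff:
  assumes "open V" "smooth_jet V n F" "smooth_jet V n G" "p \<in> jets_over V"
  shows "along v (\<lambda>q. F q - G q) p = along v F p - along v G p"
  using along_add[OF assms(1,2) smooth_jet_mult[OF assms(1) smooth_jet_const[OF assms(1), of n "-1"] assms(3)] assms(4)]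
    along_cmult[OF assms(1,3,4), of v "-1"] by simp

lemma along_sum:
  assumes "open V" "\<And>i. i \<in> A \<Longrightarrow> smooth_jet V n (F i)" "p \<in> jets_over V"
  shows "along v (\<lambda>q. \<Sum>i\<in>A. F i q) p = (\<Sum>i\<in>A. along v (F i) p)"
  using assms(2)
proof (induction A rule: infinite_finite_induct)
  case (insert i A)
  then show ?case
    using along_add[OF assms(1) _ _ assms(3), of n "F i" "\<lambda>q. \<Sum>i\<in>A. F i q" v]
    by (simp add: smooth_jet_sum[OF assms(1)])
qed simp_all

lemma along_coord: "along v (\<lambda>q. q c) p = v c"
proof -
  have "Sum_any (\<lambda>c'. v c' * pd c' (\<lambda>q. q c) p) = (\<Sum>c'\<in>{c}. v c' * pd c' (\<lambda>q. q c) p)"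
    by (rule Sum_any.expand_superset) (auto simp: pd_coord)
  then show ?thesis by (simp add: along_def pd_coord)
qed

text \<open>
  The horizontal lift of \<open>\<partial>\<^sub>i\<close>; the total derivative is the derivative along it.
\<close>

definition total_vec :: "'r \<Rightarrow> ('r, 'm) vfield" where
  "total_vec i p c = (case c of Base j \<Rightarrow> if j = i then 1 else 0 | Fib \<alpha> J \<Rightarrow> p (Fib \<alpha> (J + unit_mi i)))"

lemma total_deriv_along:
  assumes "open V" "has_order V n F" "p \<in> jets_over V"
  shows "total_deriv i F p = along (total_vec i p) F p"
proof -
  have "Sum_any (\<lambda>(\<alpha>, J). p (Fib \<alpha> (J + unit_mi i)) * pd (Fib \<alpha> J) F p) =
      (\<Sum>(\<alpha>, J)\<in>UNIV \<times> {J. mi_len J \<le> n}. p (Fib \<alpha> (J + unit_mi i)) * pd (Fib \<alpha> J) F p)"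
    by (rule Sum_any.expand_superset)
      (auto simp: finite_mi_len_le intro!: leI dest: pd_above_order[OF assms])
  also have "\<dots> = (\<Sum>\<alpha>\<in>UNIV. \<Sum>J | mi_len J \<le> n. p (Fib \<alpha> (J + unit_mi i)) * pd (Fib \<alpha> J) F p)"
    by (rule sum.cartesian_product[symmetric])
  finally show ?thesis
    unfolding total_deriv_def along_sum_coords[OF assms] sum_jet_coords
    by (simp add: total_vec_def if_distrib[of "\<lambda>x. x * _"] cong: if_cong)
qed

lemma total_deriv_cong:
  assumes "open V" "p \<in> jets_over V" "\<And>q. q \<in> jets_over V \<Longrightarrow> F q = G q"
  shows "total_deriv i F p = total_deriv i G p"
  using pd_cong[OF assms] by (simp add: total_deriv_def)

lemma along_hor_part:
  assumes "open V" "has_order V n F" "p \<in> jets_over V"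
  shows "along (hor_part p v) F p = (\<Sum>i\<in>UNIV. v (Base i) * total_deriv i F p)"
proof -
  have "hor_part p v c = (\<Sum>i\<in>UNIV. v (Base i) * total_vec i p c)" for c
    by (cases c) (auto simp: hor_part_def total_vec_def mult.commute if_distrib cong: if_cong)
  then show ?thesis
    unfolding total_deriv_along[OF assms] along_sum_coords[OF assms]
    by (simp add: sum_distrib_left sum_distrib_right mult.assoc) (rule sum.swap)
qed

lemma mi_len_add: "mi_len (I + J) = mi_len I + mi_len J"
  by (simp add: mi_len_def sum.distrib)

lemma mi_len_unit [simp]: "mi_len (unit_mi k) = 1"
  by (simp add: mi_len_def unit_mi_def)

lemma mi_len_0 [simp]: "mi_len 0 = 0"
  by (simp add: mi_len_def)

lemma smooth_jet_total_vec:
  assumes "open V" "c \<in> jet_coords n"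
  shows "smooth_jet V (n + 1) (\<lambda>q. total_vec i q c)"
proof (cases c)
  case (Base j)
  then show ?thesis by (simp add: total_vec_def smooth_jet_const[OF assms(1)])
next
  case (Fib \<alpha> J)
  then show ?thesis using assms
    by (auto simp: total_vec_def jet_coords_def mi_len_add intro!: smooth_jet_coord)
qed

lemma total_deriv_sum_coords:
  assumes "open V" "smooth_jet V n F" "p \<in> jets_over V"
  shows "total_deriv i F p = (\<Sum>c\<in>jet_coords n. total_vec i p c * pd c F p)"
  using smooth_jet_has_order[OF assms(2)]
  by (simp add: total_deriv_along[OF assms(1) _ assms(3)] along_sum_coords[OF assms(1) _ assms(3)])

lemma smooth_jet_total_deriv:
  assumes "open V" "smooth_jet V n F"
  shows "smooth_jet V (n + 1) (total_deriv i F)"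
proof (rule smooth_jet_cong[OF assms(1)])
  show "smooth_jet V (n + 1) (\<lambda>q. \<Sum>c\<in>jet_coords n. total_vec i q c * pd c F q)"
    by (intro smooth_jet_sum smooth_jet_mult smooth_jet_total_vec smooth_jet_pd assms(1))
      (auto intro: smooth_jet_mono[OF assms(2)])
qed (simp add: total_deriv_sum_coords[OF assms])

lemma total_deriv_smooth:
  assumes "open V" "p \<in> jets_over V" "smooth_jet V n F"
  shows "total_deriv i F p = along (total_vec i p) F p"
  using total_deriv_along[OF assms(1) smooth_jet_has_order[OF assms(3)] assms(2)] .

lemma total_deriv_sum:
  assumes "open V" "\<And>a. a \<in> A \<Longrightarrow> smooth_jet V n (F a)" "p \<in> jets_over V"
  shows "total_deriv i (\<lambda>q. \<Sum>a\<in>A. F a q) p = (\<Sum>a\<in>A. total_deriv i (F a) p)"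
proof -
  have "total_deriv i (\<lambda>q. \<Sum>a\<in>A. F a q) p = along (total_vec i p) (\<lambda>q. \<Sum>a\<in>A. F a q) p"
    by (rule total_deriv_smooth[OF assms(1,3)], rule smooth_jet_sum[OF assms(1,2)])
  also have "\<dots> = (\<Sum>a\<in>A. along (total_vec i p) (F a) p)"
    by (rule along_sum[OF assms])
  also have "\<dots> = (\<Sum>a\<in>A. total_deriv i (F a) p)"
    by (intro sum.cong refl, rule total_deriv_smooth[OF assms(1,3) assms(2), symmetric])
  finally show ?thesis .
qed

lemma total_deriv_add:
  assumes "open V" "smooth_jet V n F" "smooth_jet V n G" "p \<in> jets_over V"
  shows "total_deriv i (\<lambda>q. F q + G q) p = total_deriv i F p + total_deriv i G p"
  using assms(2,3) smooth_jet_add[OF assms(1-3)]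
  by (simp add: total_deriv_smooth[OF assms(1,4), where n = n] along_add[OF assms])

lemma total_deriv_diff:
  assumes "open V" "smooth_jet V n F" "smooth_jet V n G" "p \<in> jets_over V"
  shows "total_deriv i (\<lambda>q. F q - G q) p = total_deriv i F p - total_deriv i G p"
  using assms(2,3) smooth_jet_diff[OF assms(1-3)]
  by (simp add: total_deriv_smooth[OF assms(1,4), where n = n] along_diff[OF assms])

lemma total_deriv_mult:
  assumes "open V" "smooth_jet V n F" "smooth_jet V n G" "p \<in> jets_over V"
  shows "total_deriv i (\<lambda>q. F q * G q) p = total_deriv i F p * G p + F p * total_deriv i G p"
  using assms(2,3) smooth_jet_mult[OF assms(1-3)]
  by (simp add: total_deriv_smooth[OF assms(1,4), where n = n] along_mult[OF assms])

lemma total_deriv_const [simp]: "total_deriv i (\<lambda>q. a) p = 0"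
  by (simp add: total_deriv_def)

text \<open>
  The Leibniz rule applied to the finite sum that defines \<open>d\<^sub>j F\<close>. The first part comes from
  differentiating the jet coordinates in the coefficients; both parts are visibly symmetric in \<open>i\<close> and \<open>j\<close>
  once second partial derivatives commute.
\<close>

lemma total_deriv_total_deriv:
  assumes "open V" "smooth_jet V n F" "p \<in> jets_over V"
  shows "total_deriv i (total_deriv j F) p =
     (\<Sum>\<alpha>\<in>UNIV. \<Sum>J | mi_len J \<le> n. p (Fib \<alpha> (J + unit_mi j + unit_mi i)) * pd (Fib \<alpha> J) F p) +
     (\<Sum>c\<in>jet_coords n. \<Sum>c'\<in>jet_coords n. total_vec j p c * (total_vec i p c' * pd c' (pd c F) p))"
proof -
  note F' = smooth_jet_mono[OF smooth_jet_pd[OF assms(1,2)], of "n + 1"]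
  have "total_deriv i (total_deriv j F) p =
      total_deriv i (\<lambda>q. \<Sum>c\<in>jet_coords n. total_vec j q c * pd c F q) p"
    by (rule total_deriv_cong[OF assms(1,3)]) (rule total_deriv_sum_coords[OF assms(1,2)])
  also have "\<dots> = (\<Sum>c\<in>jet_coords n. total_deriv i (\<lambda>q. total_vec j q c * pd c F q) p)"
    by (rule total_deriv_sum[OF assms(1) _ assms(3), where n = "n + 1"])
      (intro smooth_jet_mult assms(1) smooth_jet_total_vec F', auto)
  also have "\<dots> = (\<Sum>c\<in>jet_coords n. total_deriv i (\<lambda>q. total_vec j q c) p * pd c F p +
      total_vec j p c * total_deriv i (pd c F) p)"
    by (intro sum.cong refl total_deriv_mult[OF assms(1) _ _ assms(3), where n = "n + 1"]
        smooth_jet_total_vec[OF assms(1)] F') auto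
  also have "\<dots> = (\<Sum>c\<in>jet_coords n. total_deriv i (\<lambda>q. total_vec j q c) p * pd c F p) +
     (\<Sum>c\<in>jet_coords n. \<Sum>c'\<in>jet_coords n. total_vec j p c * (total_vec i p c' * pd c' (pd c F) p))"
    by (simp add: sum.distrib sum_distrib_left
        total_deriv_sum_coords[OF assms(1) smooth_jet_pd[OF assms(1,2)] assms(3)])
  also have "(\<Sum>c\<in>jet_coords n. total_deriv i (\<lambda>q. total_vec j q c) p * pd c F p) =
      (\<Sum>\<alpha>\<in>UNIV. \<Sum>J | mi_len J \<le> n. p (Fib \<alpha> (J + unit_mi j + unit_mi i)) * pd (Fib \<alpha> J) F p)"
  proof -
    have "total_deriv i (\<lambda>q. q (Fib \<alpha> J)) p = p (Fib \<alpha> (J + unit_mi i))" for \<alpha> J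
      by (subst total_deriv_smooth[OF assms(1,3) smooth_jet_coord[OF assms(1)], where n = "mi_len J"])
        (auto simp: along_coord total_vec_def)
    then show ?thesis by (simp add: sum_jet_coords total_vec_def)
  qed
  finally show ?thesis .
qed

lemma total_deriv_commute:
  assumes "open V" "smooth_jet V n F" "p \<in> jets_over V"
  shows "total_deriv i (total_deriv j F) p = total_deriv j (total_deriv i F) p"
proof -
  have "(\<Sum>c\<in>jet_coords n. \<Sum>c'\<in>jet_coords n. total_vec j p c * (total_vec i p c' * pd c' (pd c F) p)) =
     (\<Sum>c\<in>jet_coords n. \<Sum>c'\<in>jet_coords n. total_vec i p c * (total_vec j p c' * pd c' (pd c F) p))"
    by (subst sum.swap) (intro sum.cong refl, simp add: pd_commute[OF assms] mult.left_commute)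
  then show ?thesis
    unfolding total_deriv_total_deriv[OF assms] by (simp add: add.assoc add.commute[of "unit_mi i"])
qed

section \<open>Total derivatives and sums over multi-indices of order at most two\<close>

lemma foldr_funpow_zero:
  assumes "\<And>i. i \<in> set xs \<Longrightarrow> J i = 0"
  shows "foldr (\<lambda>i. T i ^^ J i) xs F = F"
  using assms by (induction xs) auto

lemma foldr_funpow_single:
  assumes "distinct xs" "k \<in> set xs" "\<And>i. i \<in> set xs \<Longrightarrow> i \<noteq> k \<Longrightarrow> J i = 0"
  shows "foldr (\<lambda>i. T i ^^ J i) xs F = (T k ^^ J k) F"
  using assms
proof (induction xs)
  case (Cons x xs)
  show ?case
  proof (cases "x = k")
    case True
    then have "foldr (\<lambda>i. T i ^^ J i) xs F = F"
      using Cons.prems by (intro foldr_funpow_zero) auto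
    then show ?thesis using True by simp
  next
    case False
    then show ?thesis using Cons by auto
  qed
qed simp

lemma foldr_funpow_pair:
  fixes k j :: "'r::linorder"
  assumes "sorted xs" "distinct xs" "k \<in> set xs" "j \<in> set xs" "k < j"
    "\<And>i. i \<in> set xs \<Longrightarrow> i \<noteq> k \<Longrightarrow> i \<noteq> j \<Longrightarrow> J i = 0"
  shows "foldr (\<lambda>i. T i ^^ J i) xs F = (T k ^^ J k) ((T j ^^ J j) F)"
  using assms
proof (induction xs)
  case (Cons x xs)
  show ?case
  proof (cases "x = k")
    case True
    then have "foldr (\<lambda>i. T i ^^ J i) xs F = (T j ^^ J j) F"
      using Cons.prems by (intro foldr_funpow_single) auto
    then show ?thesis using True by simp
  next
    case False
    then have "x \<noteq> j" using Cons.prems by auto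
    then show ?thesis using Cons False by auto
  qed
qed simp

lemma total_deriv_mi_0: "total_deriv_mi 0 F = F"
  unfolding total_deriv_mi_def by (rule foldr_funpow_zero) simp

lemma total_deriv_mi_unit: "total_deriv_mi (unit_mi k) F = total_deriv k F"
  unfolding total_deriv_mi_def
  by (subst foldr_funpow_single[where k = k]) (auto simp: unit_mi_def)

text \<open>
  The definition applies the total derivatives in the fixed order of the base indices; commutativity makes
  the formula available for \<open>k\<close> and \<open>j\<close> in any order.
\<close>

lemma total_deriv_mi_pair:
  assumes "open V" "smooth_jet V n F" "p \<in> jets_over V"
  shows "total_deriv_mi (unit_mi k + unit_mi j) F p = total_deriv k (total_deriv j F) p"
proof -
  have less: "total_deriv_mi (unit_mi k + unit_mi j) F = total_deriv k (total_deriv j F)"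
    if "k < j" for k j
    unfolding total_deriv_mi_def
    by (subst foldr_funpow_pair[where k = k and j = j]) (use that in \<open>auto simp: unit_mi_def\<close>)
  have "total_deriv_mi (unit_mi k + unit_mi k) F = total_deriv k (total_deriv k F)" for k
    unfolding total_deriv_mi_def
    by (subst foldr_funpow_single[where k = k]) (auto simp: unit_mi_def numeral_2_eq_2)
  then show ?thesis
    using less[of k j] less[of j k] total_deriv_commute[OF assms, of k j]
    by (cases k j rule: linorder_cases) (auto simp: add.commute[of "unit_mi k"])
qed

lemma mi_len_SucE:
  assumes "mi_len J = Suc n"
  obtains k J' where "J = unit_mi k + J'" "mi_len J' = n"
proof -
  have "\<exists>k. J k \<noteq> 0" using assms by (rule contrapos_pp) (simp add: mi_len_def)
  then obtain k where k: "J k \<noteq> 0" by blast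
  define J' where "J' = J(k := J k - 1)"
  have J: "J = unit_mi k + J'" using k by (auto simp: J'_def unit_mi_def fun_eq_iff)
  then have "mi_len J' = n" using assms by (simp add: mi_len_add)
  with J show ?thesis by (rule that)
qed

lemma mi_len_eq_0: "mi_len J = 0 \<longleftrightarrow> J = 0"
  by (auto simp: mi_len_def fun_eq_iff)

lemma mi_len_1: "{J. mi_len J = 1} = range unit_mi"
proof -
  have "J \<in> range unit_mi" if "mi_len J = Suc 0" for J :: "'a mi"
    using that by (rule mi_len_SucE) (simp add: mi_len_eq_0)
  then show ?thesis by auto
qed

lemma mi_len_eq_2: "mi_len J = 2 \<longleftrightarrow> (\<exists>k j. J = unit_mi k + unit_mi j)"
proof
  assume "mi_len J = 2"
  then have "mi_len J = Suc (Suc 0)" by simp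
  then obtain k J' where J': "J = unit_mi k + J'" "mi_len J' = Suc 0"
    by (rule mi_len_SucE)
  from J'(2) obtain j J'' where "J' = unit_mi j + J''" "mi_len J'' = 0"
    by (rule mi_len_SucE)
  with J' show "\<exists>k j. J = unit_mi k + unit_mi j" by (auto simp: mi_len_eq_0)
qed (auto simp: mi_len_add)

lemma finite_mi_len_eq: "finite {J :: 'r::finite mi. mi_len J = n}"
  by (rule finite_subset[OF _ finite_mi_len_le[of n]]) auto

lemma inj_unit_mi: "inj unit_mi"
proof (rule injI)
  fix k j :: 'a assume "unit_mi k = unit_mi j"
  then have "unit_mi k k = unit_mi j k" by simp
  then show "k = j" by (simp add: unit_mi_def split: if_splits)
qed

lemma unit_mi_pair_eq:
  "unit_mi k + unit_mi j = unit_mi k' + unit_mi j' \<longleftrightarrow> k = k' \<and> j = j' \<or> k = j' \<and> j = k'"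
proof
  assume "unit_mi k + unit_mi j = unit_mi k' + unit_mi j'"
  then have "(unit_mi k + unit_mi j) i = (unit_mi k' + unit_mi j') i" for i
    by simp
  then have e: "unit_mi k i + unit_mi j i = unit_mi k' i + unit_mi j' i" for i
    by simp
  show "k = k' \<and> j = j' \<or> k = j' \<and> j = k'"
  proof (cases "k = k'")
    case True
    then have "unit_mi j = unit_mi j'" using e by (intro ext) simp
    then show ?thesis using True by (simp add: injD[OF inj_unit_mi])
  next
    case False
    then have "k = j'" using e[of k] by (simp add: unit_mi_def split: if_splits)
    then have "unit_mi j = unit_mi k'" using e by (intro ext) simp
    then show ?thesis using \<open>k = j'\<close> by (simp add: injD[OF inj_unit_mi])
  qed
next
  assume "k = k' \<and> j = j' \<or> k = j' \<and> j = k'"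
  then show "unit_mi k + unit_mi j = unit_mi k' + unit_mi j'"
    by (elim disjE conjE) (simp_all only: add.commute)
qed

lemma sum_mi_len_le_2:
  fixes f :: "'r::finite mi \<Rightarrow> real"
  shows "(\<Sum>J | mi_len J \<le> 2. f J) = f 0 + (\<Sum>k\<in>UNIV. f (unit_mi k)) + (\<Sum>J | mi_len J = 2. f J)"
proof -
  note fin = finite_mi_len_eq
  have "mi_len J \<le> 2 \<longleftrightarrow> J = 0 \<or> mi_len J = 1 \<or> mi_len J = 2" for J :: "'r mi"
    unfolding mi_len_eq_0[symmetric] by linarith
  then have "{J :: 'r mi. mi_len J \<le> 2} = ({0} \<union> {J. mi_len J = 1}) \<union> {J. mi_len J = 2}"
    by blast
  moreover have "sum f (({0} \<union> {J. mi_len J = 1}) \<union> {J. mi_len J = 2}) =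
      (\<Sum>J\<in>{0} \<union> {J. mi_len J = 1}. f J) + (\<Sum>J | mi_len J = 2. f J)"
    by (rule sum.union_disjoint) (auto simp: fin)
  ultimately have "(\<Sum>J | mi_len J \<le> 2. f J) =
      (\<Sum>J\<in>{0} \<union> {J. mi_len J = 1}. f J) + (\<Sum>J | mi_len J = 2. f J)"
    by simp
  also have "(\<Sum>J\<in>{0} \<union> {J. mi_len J = 1}. f J) = (\<Sum>J\<in>{0}. f J) + (\<Sum>J\<in>{J. mi_len J = 1}. f J)"
    by (rule sum.union_disjoint) (auto simp: fin)
  also have "(\<Sum>J\<in>{J. mi_len J = 1}. f J) = (\<Sum>k\<in>UNIV. f (unit_mi k))"
    unfolding mi_len_1 by (simp add: sum.reindex[OF inj_unit_mi])
  finally show ?thesis by (simp add: zero_fun_def)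
qed

text \<open>
  Multi-indices of order two are unordered pairs, whereas \<open>\<sigma>\<close> is indexed by ordered pairs: this is the sum over
  the ordered pairs representing a multi-index, i.e. the coefficient obtained on collecting terms. The
  first two relations of \<open>coeff_relations\<close> say that this coefficient is the derivative of \<open>L\<close>.
\<close>

definition pair_sum :: "('r \<Rightarrow> 'r \<Rightarrow> real) \<Rightarrow> 'r::finite mi \<Rightarrow> real" where
  "pair_sum s J = (\<Sum>(k, j) | unit_mi k + unit_mi j = J. s k j)"

lemma pair_sum_diag: "pair_sum s (unit_mi k + unit_mi k) = s k k"
proof -
  have "{x. case x of (k', j') \<Rightarrow> unit_mi k' + unit_mi j' = unit_mi k + unit_mi k} = {(k, k)}"
    by (auto simp: unit_mi_pair_eq)
  then show ?thesis by (simp add: pair_sum_def)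
qed

lemma pair_sum_offdiag:
  assumes "k \<noteq> j"
  shows "pair_sum s (unit_mi k + unit_mi j) = s k j + s j k"
proof -
  have "{x. case x of (k', j') \<Rightarrow> unit_mi k' + unit_mi j' = unit_mi k + unit_mi j} = {(k, j), (j, k)}"
    by (auto simp: unit_mi_pair_eq)
  then show ?thesis using assms by (simp add: pair_sum_def)
qed

lemma sum_pair_sum:
  fixes y :: "'r::finite mi \<Rightarrow> real"
  shows "(\<Sum>k\<in>UNIV. \<Sum>j\<in>UNIV. s k j * y (unit_mi k + unit_mi j)) = (\<Sum>J | mi_len J = 2. y J * pair_sum s J)"
proof -
  let ?g = "\<lambda>(k, j). unit_mi k + unit_mi j :: 'r mi"
  have "(\<Sum>J | mi_len J = 2. y J * pair_sum s J) =
      (\<Sum>J | mi_len J = 2. \<Sum>x | x \<in> UNIV \<and> ?g x = J. case x of (k, j) \<Rightarrow> s k j * y (?g x))"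
    by (auto simp: pair_sum_def sum_distrib_left mult.commute intro!: sum.cong)
  also have "\<dots> = (\<Sum>x\<in>UNIV. case x of (k, j) \<Rightarrow> s k j * y (?g x))"
    by (rule sum.group) (auto simp: mi_len_add finite_mi_len_eq)
  also have "\<dots> = (\<Sum>k\<in>UNIV. \<Sum>j\<in>UNIV. s k j * y (unit_mi k + unit_mi j))"
    by (simp add: UNIV_Times_UNIV[symmetric] sum.cartesian_product case_prod_unfold del: UNIV_Times_UNIV)
  finally show ?thesis by simp
qed

section \<open>The first variation\<close>

lemma lepage_apply:
  "lepage_form L \<rho> \<sigma> q vs = L q * vol q vs
     + (\<Sum>\<alpha>\<in>UNIV. \<Sum>j\<in>UNIV. \<rho> \<alpha> j q * (contact_form \<alpha> 0 \<and>\<^sub>e vol_contr j) q vs)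
     + (\<Sum>\<alpha>\<in>UNIV. \<Sum>k\<in>UNIV. \<Sum>j\<in>UNIV.
          \<sigma> \<alpha> k j q * (contact_form \<alpha> (unit_mi k) \<and>\<^sub>e vol_contr j) q vs)"
  by (simp add: lepage_form_def sum_form_apply scale_form_def)

lemma lepage_vertical:
  assumes "\<And>i. w (Base i) = 0"
  shows "lepage_form L \<rho> \<sigma> q (w # ws) =
     (\<Sum>j\<in>UNIV. ((\<Sum>\<alpha>\<in>UNIV. \<rho> \<alpha> j q * w (Fib \<alpha> 0)) +
       (\<Sum>\<alpha>\<in>UNIV. \<Sum>k\<in>UNIV. \<sigma> \<alpha> k j q * w (Fib \<alpha> (unit_mi k)))) * vol_contr j p ws)"
proof -
  have v: "vol q (w # ws) = 0" by (rule vol_vertical[of w]) (use assms in auto)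
  have "lepage_form L \<rho> \<sigma> q (w # ws) =
      (\<Sum>\<alpha>\<in>UNIV. \<Sum>j\<in>UNIV. \<rho> \<alpha> j q * (w (Fib \<alpha> 0) * vol_contr j p ws))
     + (\<Sum>\<alpha>\<in>UNIV. \<Sum>k\<in>UNIV. \<Sum>j\<in>UNIV. \<sigma> \<alpha> k j q * (w (Fib \<alpha> (unit_mi k)) * vol_contr j p ws))"
    unfolding lepage_apply v contact_wedge_vertical[of w, OF assms, where p = p] by simp
  also have "(\<Sum>\<alpha>\<in>UNIV. \<Sum>j\<in>UNIV. \<rho> \<alpha> j q * (w (Fib \<alpha> 0) * vol_contr j p ws)) =
      (\<Sum>j\<in>UNIV. \<Sum>\<alpha>\<in>UNIV. \<rho> \<alpha> j q * (w (Fib \<alpha> 0) * vol_contr j p ws))"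
    by (rule sum.swap)
  also have "(\<Sum>\<alpha>\<in>UNIV. \<Sum>k\<in>UNIV. \<Sum>j\<in>UNIV. \<sigma> \<alpha> k j q * (w (Fib \<alpha> (unit_mi k)) * vol_contr j p ws)) =
      (\<Sum>\<alpha>\<in>UNIV. \<Sum>j\<in>UNIV. \<Sum>k\<in>UNIV. \<sigma> \<alpha> k j q * (w (Fib \<alpha> (unit_mi k)) * vol_contr j p ws))"
    by (rule sum.cong[OF refl], rule sum.swap)
  also have "\<dots> = (\<Sum>j\<in>UNIV. \<Sum>\<alpha>\<in>UNIV. \<Sum>k\<in>UNIV. \<sigma> \<alpha> k j q * (w (Fib \<alpha> (unit_mi k)) * vol_contr j p ws))"
    by (rule sum.swap)
  finally show ?thesis
    by (simp add: distrib_right sum_distrib_right sum.distrib mult.assoc zero_fun_def)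
qed

lemma lepage_horizontal:
  "lepage_form L \<rho> \<sigma> q (map (hor_part p) vs) = vol p vs *
     (L q + (\<Sum>\<alpha>\<in>UNIV. \<Sum>j\<in>UNIV. \<rho> \<alpha> j q * (p (Fib \<alpha> (unit_mi j)) - q (Fib \<alpha> (unit_mi j))))
     + (\<Sum>\<alpha>\<in>UNIV. \<Sum>k\<in>UNIV. \<Sum>j\<in>UNIV. \<sigma> \<alpha> k j q *
          (p (Fib \<alpha> (unit_mi k + unit_mi j)) - q (Fib \<alpha> (unit_mi k + unit_mi j)))))"
  unfolding lepage_apply contact_wedge_horizontal
  by (simp add: vol_point[of q _ p] vol_hor algebra_simps sum_distrib_left sum_subtractf sum.distrib)

lemma along_at_zero:
  assumes "open V" "smooth_jet V n F" "smooth_jet V n G" "p \<in> jets_over V" "G p = 0"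
  shows "along v (\<lambda>q. F q * G q) p = F p * along v G p"
  using along_mult[OF assms(1-4)] assms(5) by simp

text \<open>
  The coefficient of \<open>\<Omega>\<close> in the horizontalised contraction, sorted by the order of the total derivatives of
  the field \<open>\<eta>\<close>.
\<close>

definition variation :: "('r, 'm) jfun \<Rightarrow> ('m \<Rightarrow> 'r \<Rightarrow> ('r, 'm) jfun) \<Rightarrow>
    ('m \<Rightarrow> 'r \<Rightarrow> 'r \<Rightarrow> ('r, 'm) jfun) \<Rightarrow> ('m \<Rightarrow> ('r, 'm) jfun) \<Rightarrow> ('r::{finite,linorder}, 'm::finite) jfun" where
  "variation L \<rho> \<sigma> \<eta> p = (\<Sum>\<alpha>\<in>UNIV.
      \<eta> \<alpha> p * (pd (Fib \<alpha> 0) L p - (\<Sum>j\<in>UNIV. total_deriv j (\<rho> \<alpha> j) p))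
    + (\<Sum>k\<in>UNIV. total_deriv k (\<eta> \<alpha>) p *
        (pd (Fib \<alpha> (unit_mi k)) L p - \<rho> \<alpha> k p - (\<Sum>j\<in>UNIV. total_deriv j (\<sigma> \<alpha> k j) p)))
    + (\<Sum>J | mi_len J = 2. total_deriv_mi J (\<eta> \<alpha>) p *
        (pd (Fib \<alpha> J) L p - pair_sum (\<lambda>k j. \<sigma> \<alpha> k j p) J)))"

lemma ext_d_alt_sum:
  "ext_d a p vs = alt_sum (\<lambda>v ws. along v (\<lambda>q. a q ws) p) vs"
  by (simp add: ext_d_def alt_sum_def along_def)

text \<open>
  The exterior derivative on \<open>w, h\<^sub>1, \<dots>, h\<^sub>n\<close> splits into the derivative along \<open>w\<close> (\<open>first\<close>) minus an
  alternating sum over the \<open>h\<^sub>i\<close> (\<open>second\<close>). By \<open>lepage_horizontal\<close> and \<open>lepage_vertical\<close>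
  the functions to be differentiated are explicit, and what remains is the Leibniz rule and regrouping of
  sums.
\<close>

lemma hor_contract_ext_d_lepage:
  fixes L :: "('r::{finite,linorder}, 'm::finite) jfun"
  assumes V: "open V" and L: "smooth_jet V 2 L"
    and \<rho>: "\<And>\<alpha> j. smooth_jet V 3 (\<rho> \<alpha> j)"
    and \<sigma>: "\<And>\<alpha> k j. smooth_jet V 2 (\<sigma> \<alpha> k j)"
    and p: "p \<in> jets_over V"
  shows "hor (contract (prolong 3 \<eta>) (ext_d (lepage_form L \<rho> \<sigma>))) p vs =
     variation L \<rho> \<sigma> \<eta> p * vol p vs"
proof -
  define w where "w = prolong 3 \<eta> p"
  have wB: "w (Base i) = 0" for i by (simp add: w_def prolong_def)
  have wF: "w (Fib \<alpha> J) = total_deriv_mi J (\<eta> \<alpha>) p" if "mi_len J \<le> 3" for \<alpha> J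
    using that by (simp add: w_def prolong_def)
  let ?hs = "map (hor_part p) vs"
  note L3 = smooth_jet_mono[OF L, of 3, simplified]
  note \<sigma>3 = smooth_jet_mono[OF \<sigma>, of 3, simplified]
  \<comment> \<open>These factors vanish at \<open>p\<close>, so the Leibniz rule only differentiates them and not \<open>\<rho>\<close>, \<open>\<sigma>\<close>.\<close>
  define D where "D c q = p c - q c" for c and q :: "('r, 'm) jet"
  have smD: "smooth_jet V 3 (D (Fib \<alpha> J))" if "mi_len J \<le> 3" for \<alpha> J
    unfolding D_def by (intro smooth_jet_diff smooth_jet_const smooth_jet_coord V) (use that in auto)
  have alD: "along v (D (Fib \<alpha> J)) p = - v (Fib \<alpha> J)" if "mi_len J \<le> 3" for v \<alpha> J
    unfolding D_def
    by (subst along_diff[OF V smooth_jet_const[OF V] smooth_jet_coord[OF V] p, where n = 3])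
      (use that in \<open>auto simp: along_coord\<close>)
  have len: "mi_len (unit_mi k :: 'r mi) \<le> 3" "mi_len (unit_mi k + unit_mi j :: 'r mi) \<le> 3" for k j
    by (simp_all add: mi_len_add)
  note smD = smD[OF len(1)] smD[OF len(2)] and alD = alD[OF len(1)] alD[OF len(2)]

  define S1 where "S1 q = (\<Sum>\<alpha>\<in>UNIV. \<Sum>j\<in>UNIV. \<rho> \<alpha> j q * D (Fib \<alpha> (unit_mi j)) q)" for q
  define S2 where "S2 q = (\<Sum>\<alpha>\<in>UNIV. \<Sum>k\<in>UNIV. \<Sum>j\<in>UNIV. \<sigma> \<alpha> k j q * D (Fib \<alpha> (unit_mi k + unit_mi j)) q)" for q
  have smS: "smooth_jet V 3 S1" "smooth_jet V 3 S2"
    unfolding S1_def S2_def by (intro smooth_jet_sum smooth_jet_mult V \<rho> \<sigma>3 smD)+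
  have alS1: "along w S1 p = - (\<Sum>\<alpha>\<in>UNIV. \<Sum>j\<in>UNIV. \<rho> \<alpha> j p * w (Fib \<alpha> (unit_mi j)))"
  proof -
    have "along w S1 p = (\<Sum>\<alpha>\<in>UNIV. \<Sum>j\<in>UNIV. along w (\<lambda>q. \<rho> \<alpha> j q * D (Fib \<alpha> (unit_mi j)) q) p)"
      unfolding S1_def
      by (subst along_sum[OF V _ p, where n = 3], intro smooth_jet_sum smooth_jet_mult V \<rho> smD,
          subst along_sum[OF V _ p, where n = 3], intro smooth_jet_sum smooth_jet_mult V \<rho> smD, rule refl)
    also have "\<dots> = (\<Sum>\<alpha>\<in>UNIV. \<Sum>j\<in>UNIV. \<rho> \<alpha> j p * (- w (Fib \<alpha> (unit_mi j))))"
      by (intro sum.cong refl, subst along_at_zero[OF V \<rho> smD(1) p]) (auto simp: alD, simp add: D_def)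
    finally show ?thesis by (simp add: sum_negf)
  qed
  have alS2: "along w S2 p = - (\<Sum>\<alpha>\<in>UNIV. \<Sum>k\<in>UNIV. \<Sum>j\<in>UNIV. \<sigma> \<alpha> k j p * w (Fib \<alpha> (unit_mi k + unit_mi j)))"
  proof -
    have "along w S2 p = (\<Sum>\<alpha>\<in>UNIV. \<Sum>k\<in>UNIV. \<Sum>j\<in>UNIV.
        along w (\<lambda>q. \<sigma> \<alpha> k j q * D (Fib \<alpha> (unit_mi k + unit_mi j)) q) p)"
      unfolding S2_def
      by (subst along_sum[OF V _ p, where n = 3], intro smooth_jet_sum smooth_jet_mult V \<sigma>3 smD,
          subst along_sum[OF V _ p, where n = 3], intro smooth_jet_sum smooth_jet_mult V \<sigma>3 smD,
          subst along_sum[OF V _ p, where n = 3], intro smooth_jet_sum smooth_jet_mult V \<sigma>3 smD, rule refl)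
    also have "\<dots> = (\<Sum>\<alpha>\<in>UNIV. \<Sum>k\<in>UNIV. \<Sum>j\<in>UNIV. \<sigma> \<alpha> k j p * (- w (Fib \<alpha> (unit_mi k + unit_mi j))))"
      by (intro sum.cong refl, subst along_at_zero[OF V \<sigma>3 smD(2) p]) (auto simp: alD, simp add: D_def)
    finally show ?thesis by (simp add: sum_negf)
  qed
  have alL: "along w L p = (\<Sum>\<alpha>\<in>UNIV. \<Sum>J | mi_len J \<le> 2. w (Fib \<alpha> J) * pd (Fib \<alpha> J) L p)"
    unfolding along_sum_coords[OF V smooth_jet_has_order[OF L] p] sum_jet_coords by (simp add: wB)

  have first: "along w (\<lambda>q. lepage_form L \<rho> \<sigma> q ?hs) p =
      (along w L p + along w S1 p + along w S2 p) * vol p vs"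
  proof -
    have "(\<lambda>q. lepage_form L \<rho> \<sigma> q ?hs) = (\<lambda>q. vol p vs * (L q + S1 q + S2 q))"
      by (rule ext) (simp add: lepage_horizontal S1_def S2_def D_def)
    then have "along w (\<lambda>q. lepage_form L \<rho> \<sigma> q ?hs) p = vol p vs * along w (\<lambda>q. L q + S1 q + S2 q) p"
      using along_cmult[OF V smooth_jet_add[OF V smooth_jet_add[OF V L3 smS(1)] smS(2)] p] by simp
    then show ?thesis
      by (simp add: along_add[OF V smooth_jet_add[OF V L3 smS(1)] smS(2) p] along_add[OF V L3 smS(1) p]
          mult.commute)
  qed

  \<comment> \<open>The coefficient of \<open>\<Omega>\<^sub>j\<close> in \<open>C\<^sub>q(w, \<dots>)\<close>; the vector \<open>w\<close> stays the one at \<open>p\<close> while \<open>q\<close> varies.\<close>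
  define B where "B j q = (\<Sum>\<alpha>\<in>UNIV. \<rho> \<alpha> j q * w (Fib \<alpha> 0)) +
       (\<Sum>\<alpha>\<in>UNIV. \<Sum>k\<in>UNIV. \<sigma> \<alpha> k j q * w (Fib \<alpha> (unit_mi k)))" for j q
  have smB: "smooth_jet V 3 (B j)" for j
    unfolding B_def by (intro smooth_jet_add smooth_jet_sum smooth_jet_mult smooth_jet_const V \<rho> \<sigma>3)
  have tdB: "total_deriv l (B j) p = (\<Sum>\<alpha>\<in>UNIV. total_deriv l (\<rho> \<alpha> j) p * w (Fib \<alpha> 0)) +
       (\<Sum>\<alpha>\<in>UNIV. \<Sum>k\<in>UNIV. total_deriv l (\<sigma> \<alpha> k j) p * w (Fib \<alpha> (unit_mi k)))" for l j
  proof -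
    have 1: "total_deriv l (\<lambda>q. F q * a) p = total_deriv l F p * a" if "smooth_jet V 3 F" for F a
      using total_deriv_mult[OF V that smooth_jet_const[OF V, of 3 a] p] by simp
    have "total_deriv l (B j) p = total_deriv l (\<lambda>q. \<Sum>\<alpha>\<in>UNIV. \<rho> \<alpha> j q * w (Fib \<alpha> 0)) p +
       total_deriv l (\<lambda>q. \<Sum>\<alpha>\<in>UNIV. \<Sum>k\<in>UNIV. \<sigma> \<alpha> k j q * w (Fib \<alpha> (unit_mi k))) p"
      unfolding B_def
      by (rule total_deriv_add[OF V _ _ p, where n = 3])
        (intro smooth_jet_add smooth_jet_sum smooth_jet_mult smooth_jet_const V \<rho> \<sigma>3)+
    also have "total_deriv l (\<lambda>q. \<Sum>\<alpha>\<in>UNIV. \<rho> \<alpha> j q * w (Fib \<alpha> 0)) p =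
        (\<Sum>\<alpha>\<in>UNIV. total_deriv l (\<rho> \<alpha> j) p * w (Fib \<alpha> 0))"
      by (subst total_deriv_sum[OF V _ p, where n = 3])
        (simp_all add: 1 \<rho> smooth_jet_mult smooth_jet_const V)
    also have "total_deriv l (\<lambda>q. \<Sum>\<alpha>\<in>UNIV. \<Sum>k\<in>UNIV. \<sigma> \<alpha> k j q * w (Fib \<alpha> (unit_mi k))) p =
        (\<Sum>\<alpha>\<in>UNIV. \<Sum>k\<in>UNIV. total_deriv l (\<sigma> \<alpha> k j) p * w (Fib \<alpha> (unit_mi k)))"
      by (subst total_deriv_sum[OF V _ p, where n = 3], intro smooth_jet_sum smooth_jet_mult smooth_jet_const V \<sigma>3,
          subst total_deriv_sum[OF V _ p, where n = 3], intro smooth_jet_sum smooth_jet_mult smooth_jet_const V \<sigma>3)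
        (simp add: 1 \<sigma>3)
    finally show ?thesis .
  qed
  have second: "alt_sum (\<lambda>v ws. along v (\<lambda>q. lepage_form L \<rho> \<sigma> q (w # ws)) p) ?hs =
      (\<Sum>j\<in>UNIV. total_deriv j (B j) p) * vol p vs"
  proof -
    have "alt_sum (\<lambda>v ws. along v (\<lambda>q. lepage_form L \<rho> \<sigma> q (w # ws)) p) ?hs =
        alt_sum (\<lambda>v ws. \<Sum>j\<in>UNIV. \<Sum>l\<in>UNIV. total_deriv l (B j) p * (v (Base l) * vol_contr j p ws)) ?hs"
    proof (rule alt_sum_cong)
      fix v ws assume "v \<in> set ?hs"
      then obtain u where v: "v = hor_part p u" by auto
      have "(\<lambda>q. lepage_form L \<rho> \<sigma> q (w # ws)) = (\<lambda>q. \<Sum>j\<in>UNIV. vol_contr j p ws * B j q)"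
        by (rule ext) (simp add: lepage_vertical[of w, OF wB, where p = p] B_def mult.commute)
      then have "along v (\<lambda>q. lepage_form L \<rho> \<sigma> q (w # ws)) p =
          (\<Sum>j\<in>UNIV. along v (\<lambda>q. vol_contr j p ws * B j q) p)"
        using along_sum[OF V _ p, of UNIV 3 "\<lambda>j q. vol_contr j p ws * B j q" v]
        by (simp add: smooth_jet_mult smooth_jet_const V smB)
      also have "\<dots> = (\<Sum>j\<in>UNIV. vol_contr j p ws * along v (B j) p)"
        by (simp add: along_cmult[OF V smB p])
      also have "\<dots> = (\<Sum>j\<in>UNIV. vol_contr j p ws * (\<Sum>l\<in>UNIV. v (Base l) * total_deriv l (B j) p))"
        unfolding v along_hor_part[OF V smooth_jet_has_order[OF smB] p] by (simp add: hor_part_def)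
      finally show "along v (\<lambda>q. lepage_form L \<rho> \<sigma> q (w # ws)) p =
          (\<Sum>j\<in>UNIV. \<Sum>l\<in>UNIV. total_deriv l (B j) p * (v (Base l) * vol_contr j p ws))"
        by (simp add: sum_distrib_left mult_ac)
    qed
    also have "\<dots> = (\<Sum>j\<in>UNIV. \<Sum>l\<in>UNIV. total_deriv l (B j) p * (if l = j then vol p vs else 0))"
      by (simp add: alt_sum_sum alt_sum_mult dX_wedge_vol_contr vol_hor cong: if_cong)
    also have "\<dots> = (\<Sum>j\<in>UNIV. total_deriv j (B j) p) * vol p vs"
      by (simp add: if_distrib sum_distrib_right cong: if_cong)
    finally show ?thesis .
  qed
  have "hor (contract (prolong 3 \<eta>) (ext_d (lepage_form L \<rho> \<sigma>))) p vs =
      (along w L p + along w S1 p + along w S2 p - (\<Sum>j\<in>UNIV. total_deriv j (B j) p)) * vol p vs"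
    unfolding hor_def contract_def ext_d_alt_sum w_def[symmetric] alt_sum_Cons first second
    by (simp add: algebra_simps)
  also have "along w L p + along w S1 p + along w S2 p - (\<Sum>j\<in>UNIV. total_deriv j (B j) p) =
      variation L \<rho> \<sigma> \<eta> p"
  proof -
    let ?y = "\<lambda>\<alpha> J. total_deriv_mi J (\<eta> \<alpha>) p"
    have swap1: "(\<Sum>j\<in>UNIV. \<Sum>\<alpha>\<in>UNIV. total_deriv j (\<rho> \<alpha> j) p * \<eta> \<alpha> p) =
        (\<Sum>\<alpha>\<in>UNIV. \<Sum>j\<in>UNIV. total_deriv j (\<rho> \<alpha> j) p * \<eta> \<alpha> p)"
      by (rule sum.swap)
    have "(\<Sum>j\<in>UNIV. \<Sum>\<alpha>\<in>UNIV. \<Sum>k\<in>UNIV. total_deriv j (\<sigma> \<alpha> k j) p * total_deriv k (\<eta> \<alpha>) p) =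
        (\<Sum>\<alpha>\<in>UNIV. \<Sum>j\<in>UNIV. \<Sum>k\<in>UNIV. total_deriv j (\<sigma> \<alpha> k j) p * total_deriv k (\<eta> \<alpha>) p)"
      by (rule sum.swap)
    also have "\<dots> = (\<Sum>\<alpha>\<in>UNIV. \<Sum>k\<in>UNIV. \<Sum>j\<in>UNIV. total_deriv j (\<sigma> \<alpha> k j) p * total_deriv k (\<eta> \<alpha>) p)"
      by (rule sum.cong[OF refl], rule sum.swap)
    finally have swap2: "(\<Sum>j\<in>UNIV. \<Sum>\<alpha>\<in>UNIV. \<Sum>k\<in>UNIV. total_deriv j (\<sigma> \<alpha> k j) p * total_deriv k (\<eta> \<alpha>) p) =
        (\<Sum>\<alpha>\<in>UNIV. \<Sum>k\<in>UNIV. \<Sum>j\<in>UNIV. total_deriv j (\<sigma> \<alpha> k j) p * total_deriv k (\<eta> \<alpha>) p)" .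
    have L2: "(\<Sum>J | mi_len J \<le> 2. w (Fib \<alpha> J) * pd (Fib \<alpha> J) L p) =
        \<eta> \<alpha> p * pd (Fib \<alpha> 0) L p + (\<Sum>k\<in>UNIV. total_deriv k (\<eta> \<alpha>) p * pd (Fib \<alpha> (unit_mi k)) L p) +
        (\<Sum>J | mi_len J = 2. ?y \<alpha> J * pd (Fib \<alpha> J) L p)" for \<alpha>
      unfolding sum_mi_len_le_2 by (simp add: wF total_deriv_mi_0 total_deriv_mi_unit)
    have S2: "(\<Sum>k\<in>UNIV. \<Sum>j\<in>UNIV. \<sigma> \<alpha> k j p * w (Fib \<alpha> (unit_mi k + unit_mi j))) =
        (\<Sum>J | mi_len J = 2. ?y \<alpha> J * pair_sum (\<lambda>k j. \<sigma> \<alpha> k j p) J)" for \<alpha>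
      unfolding wF[OF len(2)] by (rule sum_pair_sum)
    show ?thesis
      unfolding variation_def alL alS1 alS2 tdB S2 L2 sum.distrib wF[OF len(1)] wF[of 0, simplified]
        total_deriv_mi_0 total_deriv_mi_unit swap1 swap2
      by (simp add: sum.distrib sum_subtractf right_diff_distrib sum_distrib_left mult.commute)
  qed
  finally show ?thesis .
qed

section \<open>The coefficient relations\<close>

lemma pair_sum_relations:
  "(\<forall>J. mi_len J = 2 \<longrightarrow> g J = pair_sum s J) \<longleftrightarrow>
     (\<forall>k j. k \<noteq> j \<longrightarrow> s k j + s j k = g (unit_mi k + unit_mi j)) \<and>
     (\<forall>k. s k k = g (unit_mi k + unit_mi k))"
proof -
  have pair: "g (unit_mi k + unit_mi j) = pair_sum s (unit_mi k + unit_mi j) \<longleftrightarrow>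
      (if k = j then s k k = g (unit_mi k + unit_mi k)
       else s k j + s j k = g (unit_mi k + unit_mi j))" for k j
    by (cases "k = j") (auto simp: pair_sum_diag pair_sum_offdiag)
  have "(\<forall>J. mi_len J = 2 \<longrightarrow> g J = pair_sum s J) \<longleftrightarrow>
      (\<forall>k j. g (unit_mi k + unit_mi j) = pair_sum s (unit_mi k + unit_mi j))"
    unfolding mi_len_eq_2 by blast
  then show ?thesis unfolding pair by auto
qed

lemma coeff_relations_iff:
  "coeff_relations V L \<rho> \<sigma> \<longleftrightarrow> (\<forall>p\<in>jets_over V. \<forall>\<alpha>.
     (\<forall>J. mi_len J = 2 \<longrightarrow> pd (Fib \<alpha> J) L p = pair_sum (\<lambda>k j. \<sigma> \<alpha> k j p) J) \<and>
     (\<forall>k. \<rho> \<alpha> k p = pd (Fib \<alpha> (unit_mi k)) L p - (\<Sum>j\<in>UNIV. total_deriv j (\<sigma> \<alpha> k j) p)))"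
  unfolding coeff_relations_def pair_sum_relations conj_assoc by (rule refl)

lemma variation_relations:
  assumes "coeff_relations V L \<rho> \<sigma>" "p \<in> jets_over V"
  shows "variation L \<rho> \<sigma> \<eta> p =
    (\<Sum>\<alpha>\<in>UNIV. \<eta> \<alpha> p * (pd (Fib \<alpha> 0) L p - (\<Sum>j\<in>UNIV. total_deriv j (\<rho> \<alpha> j) p)))"
  using assms unfolding coeff_relations_iff variation_def by simp

text \<open>
  After \<open>\<rho>\<close> is substituted the right-hand side contains the sum of \<open>d\<^sub>k d\<^sub>j \<sigma>\<^sup>k\<^sup>j\<close> over ordered pairs, which
  is collected by multi-indices. Total derivatives commute, so each multi-index carries \<open>d\<^sub>J\<close> of the
  sum of \<open>\<sigma>\<close> over the pairs representing it, which the relations identify with \<open>\<partial>\<^sup>J L\<close>; this is where the freedom in the antisymmetric part disappears.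
\<close>

lemma variational_deriv_relations:
  fixes L :: "('r::{finite,linorder}, 'm::finite) jfun"
  assumes V: "open V" and L: "smooth_jet V 2 L"
    and \<sigma>: "\<And>\<alpha> k j. smooth_jet V 2 (\<sigma> \<alpha> k j)"
    and rel: "coeff_relations V L \<rho> \<sigma>" and p: "p \<in> jets_over V"
  shows "variational_deriv L \<alpha> p = pd (Fib \<alpha> 0) L p - (\<Sum>j\<in>UNIV. total_deriv j (\<rho> \<alpha> j) p)"
proof -
  let ?dd = "\<lambda>k j. total_deriv k (total_deriv j (\<sigma> \<alpha> k j)) p"
  note pdL = smooth_jet_pd[OF V L]
  note td\<sigma> = smooth_jet_total_deriv[OF V \<sigma>]
  have relD: "\<And>q. q \<in> jets_over V \<Longrightarrow> k \<noteq> j \<Longrightarrow>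
        pd (Fib \<alpha> (unit_mi k + unit_mi j)) L q = \<sigma> \<alpha> k j q + \<sigma> \<alpha> j k q"
      "\<And>q. q \<in> jets_over V \<Longrightarrow> pd (Fib \<alpha> (unit_mi k + unit_mi k)) L q = \<sigma> \<alpha> k k q"
      "\<And>q. q \<in> jets_over V \<Longrightarrow>
        \<rho> \<alpha> k q = pd (Fib \<alpha> (unit_mi k)) L q - (\<Sum>j\<in>UNIV. total_deriv j (\<sigma> \<alpha> k j) q)" for k j
    using rel unfolding coeff_relations_def by simp_all
  have \<rho>: "total_deriv k (\<rho> \<alpha> k) p = total_deriv k (pd (Fib \<alpha> (unit_mi k)) L) p - (\<Sum>j\<in>UNIV. ?dd k j)" for k
  proof -
    have "total_deriv k (\<rho> \<alpha> k) p = total_deriv k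
        (\<lambda>q. pd (Fib \<alpha> (unit_mi k)) L q - (\<Sum>j\<in>UNIV. total_deriv j (\<sigma> \<alpha> k j) q)) p"
      by (rule total_deriv_cong[OF V p relD(3)])
    also have "\<dots> = total_deriv k (pd (Fib \<alpha> (unit_mi k)) L) p
        - total_deriv k (\<lambda>q. \<Sum>j\<in>UNIV. total_deriv j (\<sigma> \<alpha> k j) q) p"
      by (rule total_deriv_diff[OF V smooth_jet_mono[OF pdL] smooth_jet_sum[OF V td\<sigma>] p]) simp
    also have "total_deriv k (\<lambda>q. \<Sum>j\<in>UNIV. total_deriv j (\<sigma> \<alpha> k j) q) p = (\<Sum>j\<in>UNIV. ?dd k j)"
      by (rule total_deriv_sum[OF V td\<sigma> p])
    finally show ?thesis .
  qed
  have second: "total_deriv_mi J (pd (Fib \<alpha> J) L) p = pair_sum ?dd J" if J2: "mi_len J = 2" for J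
  proof -
    obtain k j where J: "J = unit_mi k + unit_mi j" using J2 unfolding mi_len_eq_2 by blast
    have "total_deriv_mi J (pd (Fib \<alpha> J) L) p = total_deriv k (total_deriv j (pd (Fib \<alpha> J) L)) p"
      unfolding J by (rule total_deriv_mi_pair[OF V pdL p])
    also have "\<dots> = pair_sum ?dd J"
    proof (cases "k = j")
      case True
      have "total_deriv k (total_deriv j (pd (Fib \<alpha> J) L)) p = ?dd k k"
        unfolding J True by (intro total_deriv_cong[OF V] p relD(2))
      then show ?thesis by (simp add: J True pair_sum_diag)
    next
      case False
      have "total_deriv k (total_deriv j (pd (Fib \<alpha> J) L)) p =
          total_deriv k (total_deriv j (\<lambda>q. \<sigma> \<alpha> k j q + \<sigma> \<alpha> j k q)) p"
        unfolding J by (intro total_deriv_cong[OF V] p relD(1) False)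
      also have "\<dots> = total_deriv k (\<lambda>q. total_deriv j (\<sigma> \<alpha> k j) q + total_deriv j (\<sigma> \<alpha> j k) q) p"
        by (rule total_deriv_cong[OF V p]) (rule total_deriv_add[OF V \<sigma> \<sigma>])
      also have "\<dots> = ?dd k j + total_deriv k (total_deriv j (\<sigma> \<alpha> j k)) p"
        by (rule total_deriv_add[OF V td\<sigma> td\<sigma> p])
      also have "total_deriv k (total_deriv j (\<sigma> \<alpha> j k)) p = ?dd j k"
        by (rule total_deriv_commute[OF V \<sigma> p])
      finally show ?thesis unfolding J pair_sum_offdiag[OF False] .
    qed
    finally show ?thesis .
  qed
  have "(\<Sum>J | mi_len J = 2. total_deriv_mi J (pd (Fib \<alpha> J) L) p) = (\<Sum>k\<in>UNIV. \<Sum>j\<in>UNIV. ?dd k j)"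
    using sum_pair_sum[of ?dd "\<lambda>_. 1"] by (simp add: second)
  then show ?thesis
    unfolding variational_deriv_def sum_mi_len_le_2
    by (simp add: total_deriv_mi_0 total_deriv_mi_unit \<rho> sum_negf sum_subtractf)
qed

definition single_field :: "'m \<Rightarrow> ('r, 'm) jfun \<Rightarrow> 'm \<Rightarrow> ('r, 'm) jfun" where
  "single_field \<alpha> F \<beta> = (if \<beta> = \<alpha> then F else (\<lambda>_. 0))"

lemma total_deriv_mi_const:
  assumes "open V" "p \<in> jets_over V" "mi_len J = 2"
  shows "total_deriv_mi J (\<lambda>_. a) p = 0"
proof -
  obtain k j where J: "J = unit_mi k + unit_mi j" using assms(3) unfolding mi_len_eq_2 by blast
  have "total_deriv_mi J (\<lambda>_. a) p = total_deriv k (total_deriv j (\<lambda>_. a)) p"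
    unfolding J by (rule total_deriv_mi_pair[OF assms(1) smooth_jet_const[OF assms(1)] assms(2)])
  also have "\<dots> = total_deriv k (\<lambda>_. 0) p"
    by (rule total_deriv_cong[OF assms(1,2) total_deriv_const])
  finally show ?thesis by simp
qed

lemma variation_single_field:
  assumes "open V" "p \<in> jets_over V"
  shows "variation L \<rho> \<sigma> (single_field \<alpha> F) p =
      F p * (pd (Fib \<alpha> 0) L p - (\<Sum>j\<in>UNIV. total_deriv j (\<rho> \<alpha> j) p))
    + (\<Sum>k\<in>UNIV. total_deriv k F p *
        (pd (Fib \<alpha> (unit_mi k)) L p - \<rho> \<alpha> k p - (\<Sum>j\<in>UNIV. total_deriv j (\<sigma> \<alpha> k j) p)))
    + (\<Sum>J | mi_len J = 2. total_deriv_mi J F p *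
        (pd (Fib \<alpha> J) L p - pair_sum (\<lambda>k j. \<sigma> \<alpha> k j p) J))"
proof -
  let ?t = "\<lambda>F \<beta>. F p * (pd (Fib \<beta> 0) L p - (\<Sum>j\<in>UNIV. total_deriv j (\<rho> \<beta> j) p))
    + (\<Sum>k\<in>UNIV. total_deriv k F p *
        (pd (Fib \<beta> (unit_mi k)) L p - \<rho> \<beta> k p - (\<Sum>j\<in>UNIV. total_deriv j (\<sigma> \<beta> k j) p)))
    + (\<Sum>J | mi_len J = 2. total_deriv_mi J F p *
        (pd (Fib \<beta> J) L p - pair_sum (\<lambda>k j. \<sigma> \<beta> k j p) J))"
  have zero: "?t (\<lambda>_. 0) \<beta> = 0" for \<beta>
    by (simp add: total_deriv_mi_const[OF assms])
  have "variation L \<rho> \<sigma> (single_field \<alpha> F) p = (\<Sum>\<beta>\<in>UNIV. ?t (single_field \<alpha> F \<beta>) \<beta>)"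
    by (simp only: variation_def)
  also have "\<dots> = (\<Sum>\<beta>\<in>{\<alpha>}. ?t (single_field \<alpha> F \<beta>) \<beta>)"
  proof (rule sum.mono_neutral_right)
    show "\<forall>\<beta>\<in>UNIV - {\<alpha>}. ?t (single_field \<alpha> F \<beta>) \<beta> = 0"
    proof
      fix \<beta> assume "\<beta> \<in> UNIV - {\<alpha>}"
      then have "single_field \<alpha> F \<beta> = (\<lambda>_. 0)" by (simp add: single_field_def)
      then show "?t (single_field \<alpha> F \<beta>) \<beta> = 0" by (simp only: zero)
    qed
  qed simp_all
  also have "\<dots> = ?t F \<alpha>"
  proof -
    have "single_field \<alpha> F \<alpha> = F" by (simp add: single_field_def)
    then show ?thesis by (simp only: sum.insert finite.emptyI empty_iff not_False_eq_True sum.empty add_0_right)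
  qed
  finally show ?thesis .
qed

text \<open>
  If the first variation involves only the values of \<open>\<eta>\<close>, then inserting fields that vanish at \<open>p\<close> isolates
  the coefficients of the derivatives. Linear functions of \<open>X - X(p)\<close> have no second total derivatives, and a
  product of two coordinates has exactly one nonzero second total derivative at \<open>p\<close>.
\<close>

lemma variation_algebraic_imp_relations:
  fixes L :: "('r::{finite,linorder}, 'm::finite) jfun"
  assumes V: "open V"
    and alg: "\<And>\<eta> p. vertical_field V \<eta> \<Longrightarrow> p \<in> jets_over V \<Longrightarrow>
      variation L \<rho> \<sigma> \<eta> p = (\<Sum>\<alpha>\<in>UNIV. A \<alpha> p * \<eta> \<alpha> p)"
  shows "coeff_relations V L \<rho> \<sigma>"
  unfolding coeff_relations_iff
proof (intro ballI allI)
  fix p :: "('r, 'm) jet" and \<alpha> :: 'm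
  assume p: "p \<in> jets_over V"
  define e0 where "e0 = pd (Fib \<alpha> 0) L p - (\<Sum>j\<in>UNIV. total_deriv j (\<rho> \<alpha> j) p)"
  define e1 where "e1 k = pd (Fib \<alpha> (unit_mi k)) L p - \<rho> \<alpha> k p - (\<Sum>j\<in>UNIV. total_deriv j (\<sigma> \<alpha> k j) p)" for k
  define e2 where "e2 J = pd (Fib \<alpha> J) L p - pair_sum (\<lambda>k j. \<sigma> \<alpha> k j p) J" for J
  have test: "A \<alpha> p * F p = F p * e0 + (\<Sum>k\<in>UNIV. total_deriv k F p * e1 k) +
      (\<Sum>J | mi_len J = 2. total_deriv_mi J F p * e2 J)" if F: "smooth_jet V 0 F" for F
  proof -
    have "vertical_field V (single_field \<alpha> F)"
      using F smooth_jet_const[OF V] by (auto simp: vertical_field_def single_field_def)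
    from alg[OF this p] have "variation L \<rho> \<sigma> (single_field \<alpha> F) p =
        (\<Sum>\<beta>\<in>UNIV. A \<beta> p * single_field \<alpha> F \<beta> p)" .
    also have "\<dots> = (\<Sum>\<beta>\<in>UNIV. if \<beta> = \<alpha> then A \<beta> p * F p else 0)"
      by (rule sum.cong) (simp_all add: single_field_def)
    also have "\<dots> = A \<alpha> p * F p" by simp
    finally show ?thesis
      unfolding variation_single_field[OF V p] e0_def e1_def e2_def by (rule sym)
  qed
  define X where "X l q = q (Base l) - p (Base l)" for l and q :: "('r, 'm) jet"
  have smX: "smooth_jet V 0 (X l)" for l
    unfolding X_def by (intro smooth_jet_diff smooth_jet_const smooth_jet_coord V) auto
  have Xp: "X l p = 0" for l by (simp add: X_def)
  have tdX: "total_deriv k (X l) q = (if l = k then 1 else 0)" if "q \<in> jets_over V" for k l q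
  proof -
    have "total_deriv k (X l) q = along (total_vec k q) (X l) q"
      by (rule total_deriv_smooth[OF V that smX])
    also have "\<dots> = along (total_vec k q) (\<lambda>q. q (Base l)) q"
      unfolding X_def
      by (subst along_diff[OF V smooth_jet_coord[OF V] smooth_jet_const[OF V] that, where n = 0]) auto
    finally show ?thesis by (simp add: along_coord total_vec_def)
  qed

  have e1: "e1 l = 0" for l
  proof -
    have "total_deriv_mi J (X l) p = 0" if J2: "mi_len J = 2" for J
    proof -
      obtain k j where J: "J = unit_mi k + unit_mi j" using J2 unfolding mi_len_eq_2 by blast
      have "total_deriv_mi J (X l) p = total_deriv k (total_deriv j (X l)) p"
        unfolding J by (rule total_deriv_mi_pair[OF V smX p])
      also have "\<dots> = total_deriv k (\<lambda>q. if l = j then 1 else 0) p"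
        by (rule total_deriv_cong[OF V p tdX])
      finally show ?thesis by simp
    qed
    then have "(\<Sum>J | mi_len J = 2. total_deriv_mi J (X l) p * e2 J) = 0" by simp
    moreover have "(\<Sum>k\<in>UNIV. total_deriv k (X l) p * e1 k) = (\<Sum>k\<in>UNIV. if l = k then e1 k else 0)"
      by (rule sum.cong) (simp_all add: tdX[OF p])
    ultimately show ?thesis using test[OF smX, of l] by (simp add: Xp)
  qed

  have e2: "e2 J = 0" if J2: "mi_len J = 2" for J
  proof -
    obtain l m where J: "J = unit_mi l + unit_mi m" using J2 unfolding mi_len_eq_2 by blast
    let ?F = "\<lambda>q. X l q * X m q"
    define \<delta> where "\<delta> a b = (if a = b then 1 else 0 :: real)" for a b :: 'r
    have smF: "smooth_jet V 0 ?F" by (intro smooth_jet_mult smX V)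
    have tdF: "total_deriv j ?F q = \<delta> l j * X m q + \<delta> m j * X l q" if "q \<in> jets_over V" for j q
      by (simp add: total_deriv_mult[OF V smX smX that] tdX[OF that] \<delta>_def)
    have tdJ: "total_deriv_mi (unit_mi k + unit_mi j) ?F p = \<delta> l j * \<delta> m k + \<delta> m j * \<delta> l k" for k j
    proof -
      have cX: "total_deriv k (\<lambda>q. a * X i q) p = a * \<delta> i k" for a i
        by (simp add: total_deriv_mult[OF V smooth_jet_const[OF V] smX p] tdX[OF p] \<delta>_def)
      have "total_deriv_mi (unit_mi k + unit_mi j) ?F p = total_deriv k (total_deriv j ?F) p"
        by (rule total_deriv_mi_pair[OF V smF p])
      also have "\<dots> = total_deriv k (\<lambda>q. \<delta> l j * X m q + \<delta> m j * X l q) p"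
        by (rule total_deriv_cong[OF V p tdF])
      also have "\<dots> = total_deriv k (\<lambda>q. \<delta> l j * X m q) p + total_deriv k (\<lambda>q. \<delta> m j * X l q) p"
        by (rule total_deriv_add[OF V smooth_jet_mult[OF V smooth_jet_const[OF V] smX]
              smooth_jet_mult[OF V smooth_jet_const[OF V] smX] p])
      finally show ?thesis by (simp add: cX)
    qed
    have zero: "total_deriv_mi I ?F p = 0" if I: "mi_len I = 2" "I \<noteq> J" for I
    proof -
      obtain k j where "I = unit_mi k + unit_mi j" using I unfolding mi_len_eq_2 by blast
      then show ?thesis using I(2) by (auto simp: tdJ J unit_mi_pair_eq \<delta>_def)
    qed
    have "(\<Sum>I | mi_len I = 2. total_deriv_mi I ?F p * e2 I) = (\<Sum>I\<in>{J}. total_deriv_mi I ?F p * e2 I)"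
      by (rule sum.mono_neutral_right[OF finite_mi_len_eq]) (use J2 zero in auto)
    then have "total_deriv_mi J ?F p * e2 J = 0"
      using test[OF smF] by (simp add: Xp tdF[OF p])
    moreover have "total_deriv_mi J ?F p \<noteq> 0" by (auto simp: J tdJ \<delta>_def)
    ultimately show ?thesis by simp
  qed

  show "(\<forall>J. mi_len J = 2 \<longrightarrow> pd (Fib \<alpha> J) L p = pair_sum (\<lambda>k j. \<sigma> \<alpha> k j p) J) \<and>
     (\<forall>k. \<rho> \<alpha> k p = pd (Fib \<alpha> (unit_mi k)) L p - (\<Sum>j\<in>UNIV. total_deriv j (\<sigma> \<alpha> k j) p))"
    using e1 e2 unfolding e1_def e2_def by (auto simp: algebra_simps)
qed

lemma contract_lepage:
  "contract (prolong 3 \<eta>) (lepage_form L \<rho> \<sigma>) p vs =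
     (\<Sum>i\<in>UNIV. ((\<Sum>\<alpha>\<in>UNIV. \<rho> \<alpha> i p * \<eta> \<alpha> p) +
        (\<Sum>\<alpha>\<in>UNIV. \<Sum>k\<in>UNIV. \<sigma> \<alpha> k i p * total_deriv k (\<eta> \<alpha>) p)) * vol_contr i p vs)"
  unfolding contract_def
  by (subst lepage_vertical[where p = p])
    (simp_all add: prolong_def total_deriv_mi_0 total_deriv_mi_unit)

section \<open>Boundary expressions and the theorem\<close>

lemma contract_lepage_bdry:
  assumes "\<And>\<alpha> k. k \<noteq> last_ix \<Longrightarrow> \<sigma> \<alpha> k last_ix p = 0"
    and "\<And>v. v \<in> set vs \<Longrightarrow> v (Base last_ix) = 0"
  shows "contract (prolong 3 \<eta>) (lepage_form L \<rho> \<sigma>) p vs =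
     (\<Sum>\<alpha>\<in>UNIV. \<rho> \<alpha> last_ix p * \<eta> \<alpha> p
        + \<sigma> \<alpha> last_ix last_ix p * total_deriv last_ix (\<eta> \<alpha>) p) * vol_bdry p vs"
proof -
  have \<sigma>: "(\<Sum>k\<in>UNIV. \<sigma> \<alpha> k last_ix p * total_deriv k (\<eta> \<alpha>) p) =
      \<sigma> \<alpha> last_ix last_ix p * total_deriv last_ix (\<eta> \<alpha>) p" for \<alpha>
    by (subst sum.remove[of _ last_ix]) (auto simp: assms(1))
  have "vol_contr i p vs = 0" if "i \<noteq> last_ix" for i
    using assms(2) that by (rule vol_contr_bdry[where l = last_ix])
  then show ?thesis
    unfolding contract_lepage
    by (subst sum.remove[of _ last_ix]) (auto simp: \<sigma> sum.distrib vol_bdry_def)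
qed

theorem mainTheorem1:
  fixes V :: "((real^'r::{finite,linorder}) \<times> (real^'m::finite)) set"
    and L :: "('r, 'm) jfun"
    and \<rho> :: "'m \<Rightarrow> 'r \<Rightarrow> ('r, 'm) jfun"
    and \<sigma> :: "'m \<Rightarrow> 'r \<Rightarrow> 'r \<Rightarrow> ('r, 'm) jfun"
  assumes "open V"
    and "smooth_jet V 2 L"
    and "\<And>\<alpha> j. smooth_jet V 3 (\<rho> \<alpha> j)"
    and "\<And>\<alpha> k j. smooth_jet V 2 (\<sigma> \<alpha> k j)"
  shows
    "((\<exists>A. (\<forall>\<alpha>. smooth_jet V 4 (A \<alpha>)) \<and>
          (\<forall>\<eta>. vertical_field V \<eta> \<longrightarrow>
             form_eq_on V (hor (contract (prolong 3 \<eta>) (ext_d (lepage_form L \<rho> \<sigma>))))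
               ((\<lambda>p. \<Sum>\<alpha>\<in>UNIV. A \<alpha> p * \<eta> \<alpha> p) \<odot> vol)))
        \<longleftrightarrow> coeff_relations V L \<rho> \<sigma>)
     \<and> (coeff_relations V L \<rho> \<sigma> \<longrightarrow>
          (\<forall>\<eta>. vertical_field V \<eta> \<longrightarrow>
             form_eq_on V (hor (contract (prolong 3 \<eta>) (ext_d (lepage_form L \<rho> \<sigma>))))
               ((\<lambda>p. \<Sum>\<alpha>\<in>UNIV. \<eta> \<alpha> p * variational_deriv L \<alpha> p) \<odot> vol)))
     \<and> (coeff_relations V L \<rho> \<sigma> \<longrightarrow>
          (\<forall>\<eta>. vertical_field V \<eta> \<longrightarrow>
             form_eq_on V (contract (prolong 3 \<eta>) (lepage_form L \<rho> \<sigma>))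
               (\<Sum>i\<in>UNIV. (\<lambda>p. (\<Sum>\<alpha>\<in>UNIV. \<rho> \<alpha> i p * \<eta> \<alpha> p)
                   + (\<Sum>\<alpha>\<in>UNIV. \<Sum>k\<in>UNIV. \<sigma> \<alpha> k i p * total_deriv k (\<eta> \<alpha>) p)) \<odot> vol_contr i)))
     \<and> (coeff_relations V L \<rho> \<sigma> \<and>
        (\<forall>\<alpha> k. k \<noteq> last_ix \<longrightarrow> (\<forall>p \<in> jets_over V. \<sigma> \<alpha> k last_ix p = 0)) \<longrightarrow>
          (\<forall>\<alpha> k. \<forall>p \<in> jets_over V.
             \<sigma> \<alpha> last_ix k p = pd (Fib \<alpha> (unit_mi last_ix + unit_mi k)) L p) \<and>
          (\<forall>\<alpha>. \<forall>p \<in> jets_over V.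
             \<rho> \<alpha> last_ix p = pd (Fib \<alpha> (unit_mi last_ix)) L p
               - (\<Sum>k\<in>UNIV. total_deriv k (pd (Fib \<alpha> (unit_mi last_ix + unit_mi k)) L) p)) \<and>
          (\<forall>\<alpha>. \<forall>p \<in> jets_over V.
             \<sigma> \<alpha> last_ix last_ix p = pd (Fib \<alpha> (unit_mi last_ix + unit_mi last_ix)) L p) \<and>
          (\<forall>\<eta> c. vertical_field V \<eta> \<longrightarrow>
             form_eq_on_bdry V c (contract (prolong 3 \<eta>) (lepage_form L \<rho> \<sigma>))
               ((\<lambda>p. \<Sum>\<alpha>\<in>UNIV. \<rho> \<alpha> last_ix p * \<eta> \<alpha> p
                   + \<sigma> \<alpha> last_ix last_ix p * total_deriv last_ix (\<eta> \<alpha>) p) \<odot> vol_bdry)))"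
proof -
  note V = assms(1) and L = assms(2) and \<rho> = assms(3) and \<sigma> = assms(4)
  have variation: "hor (contract (prolong 3 \<eta>) (ext_d (lepage_form L \<rho> \<sigma>))) p vs =
      variation L \<rho> \<sigma> \<eta> p * vol p vs" if "p \<in> jets_over V" for \<eta> p vs
    by (rule hor_contract_ext_d_lepage[OF V L \<rho> \<sigma> that])
  have euler: "form_eq_on V (hor (contract (prolong 3 \<eta>) (ext_d (lepage_form L \<rho> \<sigma>))))
      ((\<lambda>p. \<Sum>\<alpha>\<in>UNIV. (pd (Fib \<alpha> 0) L p - (\<Sum>j\<in>UNIV. total_deriv j (\<rho> \<alpha> j) p)) * \<eta> \<alpha> p) \<odot> vol)"
    if "coeff_relations V L \<rho> \<sigma>" for \<eta>
    by (auto simp: form_eq_on_def scale_form_def variation variation_relations[OF that] mult.commute)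
  have smE: "smooth_jet V 4 (\<lambda>p. pd (Fib \<alpha> 0) L p - (\<Sum>j\<in>UNIV. total_deriv j (\<rho> \<alpha> j) p))" for \<alpha>
  proof -
    have "smooth_jet V 4 (total_deriv j (\<rho> \<alpha> j))" for j
      using smooth_jet_total_deriv[OF V \<rho>, of j \<alpha> j] by simp
    then show ?thesis
      by (intro smooth_jet_diff smooth_jet_sum V smooth_jet_mono[OF smooth_jet_pd[OF V L]]) auto
  qed
  have necessary: "coeff_relations V L \<rho> \<sigma>"
    if A: "\<And>\<eta>. vertical_field V \<eta> \<Longrightarrow>
      form_eq_on V (hor (contract (prolong 3 \<eta>) (ext_d (lepage_form L \<rho> \<sigma>))))
        ((\<lambda>p. \<Sum>\<alpha>\<in>UNIV. A \<alpha> p * \<eta> \<alpha> p) \<odot> vol)" for A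
  proof (rule variation_algebraic_imp_relations[OF V])
    fix \<eta> :: "'m \<Rightarrow> ('r, 'm) jfun" and p assume \<eta>: "vertical_field V \<eta>" and p: "p \<in> jets_over V"
    obtain vs where vs: "vol p vs \<noteq> 0" using vol_nonzero by blast
    have "variation L \<rho> \<sigma> \<eta> p * vol p vs = (\<Sum>\<alpha>\<in>UNIV. A \<alpha> p * \<eta> \<alpha> p) * vol p vs"
      using A[OF \<eta>] p unfolding variation[OF p, symmetric] form_eq_on_def scale_form_def by blast
    then show "variation L \<rho> \<sigma> \<eta> p = (\<Sum>\<alpha>\<in>UNIV. A \<alpha> p * \<eta> \<alpha> p)" using vs by simp
  qed
  have domain: "(\<exists>A. (\<forall>\<alpha>. smooth_jet V 4 (A \<alpha>)) \<and>
          (\<forall>\<eta>. vertical_field V \<eta> \<longrightarrow>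
             form_eq_on V (hor (contract (prolong 3 \<eta>) (ext_d (lepage_form L \<rho> \<sigma>))))
               ((\<lambda>p. \<Sum>\<alpha>\<in>UNIV. A \<alpha> p * \<eta> \<alpha> p) \<odot> vol)))
        \<longleftrightarrow> coeff_relations V L \<rho> \<sigma>" (is "?lhs \<longleftrightarrow> ?rel")
  proof
    assume ?lhs
    then show ?rel using necessary by blast
  next
    assume ?rel
    with euler smE show ?lhs
      by (intro exI[of _ "\<lambda>\<alpha> p. pd (Fib \<alpha> 0) L p - (\<Sum>j\<in>UNIV. total_deriv j (\<rho> \<alpha> j) p)"]) blast
  qed
  have euler_lagrange: "form_eq_on V (hor (contract (prolong 3 \<eta>) (ext_d (lepage_form L \<rho> \<sigma>))))
      ((\<lambda>p. \<Sum>\<alpha>\<in>UNIV. \<eta> \<alpha> p * variational_deriv L \<alpha> p) \<odot> vol)"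
    if rel: "coeff_relations V L \<rho> \<sigma>" for \<eta>
    using euler[OF rel]
    by (simp add: form_eq_on_def scale_form_def variational_deriv_relations[OF V L \<sigma> rel] mult.commute)
  have boundary: "form_eq_on V (contract (prolong 3 \<eta>) (lepage_form L \<rho> \<sigma>))
      (\<Sum>i\<in>UNIV. (\<lambda>p. (\<Sum>\<alpha>\<in>UNIV. \<rho> \<alpha> i p * \<eta> \<alpha> p)
          + (\<Sum>\<alpha>\<in>UNIV. \<Sum>k\<in>UNIV. \<sigma> \<alpha> k i p * total_deriv k (\<eta> \<alpha>) p)) \<odot> vol_contr i)" for \<eta>
    by (simp add: form_eq_on_def sum_form_apply scale_form_def contract_lepage)
  have adapted: "(\<forall>\<alpha> k. \<forall>p \<in> jets_over V.
             \<sigma> \<alpha> last_ix k p = pd (Fib \<alpha> (unit_mi last_ix + unit_mi k)) L p) \<and>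
          (\<forall>\<alpha>. \<forall>p \<in> jets_over V.
             \<rho> \<alpha> last_ix p = pd (Fib \<alpha> (unit_mi last_ix)) L p
               - (\<Sum>k\<in>UNIV. total_deriv k (pd (Fib \<alpha> (unit_mi last_ix + unit_mi k)) L) p)) \<and>
          (\<forall>\<alpha>. \<forall>p \<in> jets_over V.
             \<sigma> \<alpha> last_ix last_ix p = pd (Fib \<alpha> (unit_mi last_ix + unit_mi last_ix)) L p) \<and>
          (\<forall>\<eta> c. vertical_field V \<eta> \<longrightarrow>
             form_eq_on_bdry V c (contract (prolong 3 \<eta>) (lepage_form L \<rho> \<sigma>))
               ((\<lambda>p. \<Sum>\<alpha>\<in>UNIV. \<rho> \<alpha> last_ix p * \<eta> \<alpha> p
                   + \<sigma> \<alpha> last_ix last_ix p * total_deriv last_ix (\<eta> \<alpha>) p) \<odot> vol_bdry))"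
    if rel: "coeff_relations V L \<rho> \<sigma>"
      and zero: "\<forall>\<alpha> k. k \<noteq> last_ix \<longrightarrow> (\<forall>p \<in> jets_over V. \<sigma> \<alpha> k last_ix p = 0)"
  proof -
    have \<sigma>L: "\<sigma> \<alpha> last_ix k p = pd (Fib \<alpha> (unit_mi last_ix + unit_mi k)) L p"
      if "p \<in> jets_over V" for \<alpha> k p
    proof (cases "k = last_ix")
      case True
      then show ?thesis using rel that by (simp add: coeff_relations_def)
    next
      case False
      then have "\<sigma> \<alpha> last_ix k p + \<sigma> \<alpha> k last_ix p = pd (Fib \<alpha> (unit_mi last_ix + unit_mi k)) L p"
        using rel that unfolding coeff_relations_def by metis
      then show ?thesis using zero that False by simp
    qed
    have \<rho>L: "\<rho> \<alpha> last_ix p = pd (Fib \<alpha> (unit_mi last_ix)) L p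
        - (\<Sum>k\<in>UNIV. total_deriv k (pd (Fib \<alpha> (unit_mi last_ix + unit_mi k)) L) p)"
      if p: "p \<in> jets_over V" for \<alpha> p
    proof -
      have "total_deriv k (\<sigma> \<alpha> last_ix k) p = total_deriv k (pd (Fib \<alpha> (unit_mi last_ix + unit_mi k)) L) p" for k
        by (rule total_deriv_cong[OF V p \<sigma>L])
      then show ?thesis using rel p by (simp add: coeff_relations_def)
    qed
    have "form_eq_on_bdry V c (contract (prolong 3 \<eta>) (lepage_form L \<rho> \<sigma>))
         ((\<lambda>p. \<Sum>\<alpha>\<in>UNIV. \<rho> \<alpha> last_ix p * \<eta> \<alpha> p
             + \<sigma> \<alpha> last_ix last_ix p * total_deriv last_ix (\<eta> \<alpha>) p) \<odot> vol_bdry)" for \<eta> c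
      unfolding form_eq_on_bdry_def scale_form_def
      by (intro ballI impI allI contract_lepage_bdry) (use zero in auto)
    then show ?thesis using \<sigma>L \<rho>L by blast
  qed
  show ?thesis
    using domain euler_lagrange boundary adapted by blast
qed

end
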